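(* Let $G=\{V,E\}$, $V=\{1,\dots,N\}$, be a connected undirected graph. For each $i\in V$ let $f_i,g_i:\mathbb{R}^M\to(-\infty,+\infty]$ be proper, convex and closed, with $f_i$ differentiable and $\sigma_i$-strongly convex, $\sigma_i>0$; let $X_i\subseteq\mathbb{R}^M$ be non-empty, convex and closed, and suppose there is $\breve{\mathbf{x}}\in\mathbf{relint}\,X$, $X=X_1\times\cdots\times X_N$, with $\mathbf{A}\breve{\mathbf{x}}=\mathbf{b}$. Let $P,Q,\mathbf{M},\mathcal{L}$, the set $C$ of saddle points of $\mathcal{L}$ (assumed non-empty), and $h=\max_{i\in V}h_i$ with $h_i=\|\mathbf{H}_i\|^2/\sigma_i$ be as defined in the context. If the step sizes $c,\gamma>0$ satisfy $$c^{-1}\ \ge\ h+\gamma\,\overline{\tau}(\mathbf{M}^{\top}\mathbf{M}),$$ then, for any initialization $(\bm{\lambda}^0,\bm{\xi}^0)$, the sequence $\{(\bm{\lambda}^t,\bm{\xi}^t)\}_{t\in\mathbb{N}}$ generated by the DDPG algorithm $$\bm{\lambda}^{t+1}=\mathrm{prox}^{c}_{Q}\big[\bm{\lambda}^t-c(\nabla P(\bm{\lambda}^t)+\mathbf{M}^{\top}\bm{\xi}^t+\gamma\mathbf{M}^{\top}\mathbf{M}\bm{\lambda}^t)\big],\qquad \bm{\xi}^{t+1}=\bm{\xi}^t+\gamma\mathbf{M}\bm{\lambda}^{t+1}$$ converges to a primal-dual solution of the problem $\min_{\bm{\lambda}}\{P(\bm{\lambda})+Q(\bm{\lambda})\}$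 s.t. $\mathbf{M}\bm{\lambda}=\mathbf{0}$; that is, there exists $(\hat{\bm{\lambda}},\hat{\bm{\xi}})\in C$ with $\lim_{t\to\infty}\bm{\lambda}^t=\hat{\bm{\lambda}}$ and $\lim_{t\to\infty}\bm{\xi}^t=\hat{\bm{\xi}}$.
   Context: Primal problem: $\min_{\mathbf{x}\in X}\sum_{i\in V}(f_i(\mathbf{x}_i)+g_i(\mathbf{x}_i))$ s.t. $\mathbf{A}\mathbf{x}=\mathbf{b}$, with $\mathbf{x}=[\mathbf{x}_1^\top,\dots,\mathbf{x}_N^\top]^\top\in\mathbb{R}^{NM}$, $\mathbf{A}=[\mathbf{A}_1,\dots,\mathbf{A}_N]\in\mathbb{R}^{B\times NM}$, $\mathbf{A}_i\in\mathbb{R}^{B\times M}$, $\mathbf{b}\in\mathbb{R}^B$. $\mathbb{I}_{X_i}$ is the indicator function of $X_i$ ($0$ on $X_i$, $+\infty$ elsewhere); $g_i+\mathbb{I}_{X_i}$ is taken to be proper. Graph: edges are unordered pairs $(i,j)$ with $i\neq j$ (no self-loops), numbered $e_1,\dots,e_{|E|}$ in lexicographic order of (smaller endpoint, larger endpoint). The incidence matrix $\mathbf{Q}\in\mathbb{R}^{N\times|E|}$ has $[\mathbf{Q}]_{jk}=1$ if $e_k=(j,l)$ with $j<l$, $-1$ if $e_k=(j,l)$ with $j>l$, and $0$ otherwise. Notation: $\psi^{\diamond}(\mathbf{v})=\sup_{\mathbf{u}}\{\mathbf{v}^\top\mathbf{u}-\psi(\mathbf{u})\}$ is the Fenchel conjugate;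 $\mathrm{prox}^{\alpha}_{\psi}[\mathbf{v}]=\arg\min_{\mathbf{u}}(\psi(\mathbf{u})+\frac{1}{2\alpha}\|\mathbf{u}-\mathbf{v}\|^2)$; $\overline{\tau}(\cdot)$ is the largest eigenvalue; $\otimes$ is the Kronecker product; $\|\cdot\|$ is the Euclidean norm for vectors and the spectral norm for matrices; $\mathbf{relint}$ is the relative interior. Dual objects: $\mathbf{H}_i=[-\mathbf{A}_i^\top,-\mathbf{I}_M]\in\mathbb{R}^{M\times(M+B)}$, $\mathbf{F}=[\mathbf{O}_{M\times B},\mathbf{I}_M]$, $\mathbf{E}=[\mathbf{b}^\top,\mathbf{0}_M^\top]\in\mathbb{R}^{1\times(M+B)}$, $\mathbf{K}=[\mathbf{I}_B,\mathbf{O}_{B\times M}]$, and real numbers $\kappa_i$ with $\sum_{i\in V}\kappa_i=1$. The variable is $\bm{\lambda}=[\bm{\lambda}_1^\top,\dots,\bm{\lambda}_N^\top]^\top$, $\bm{\lambda}_i=[\bm{\theta}_i^\top,\bm{\mu}_i^\top]^\top\in\mathbb{R}^{B+M}$ with $\bm{\theta}_i\in\mathbb{R}^B$, $\bm{\mu}_i\in\mathbb{R}^M$. Put $p_i(\bm{\lambda}_i)=f_i^{\diamond}(\mathbf{H}_i\bm{\lambda}_i)+\kappa_i\mathbf{E}\bm{\lambda}_i$, $q_i(\bm{\lambda}_i)=(g_i+\mathbb{I}_{X_i})^{\diamond}(\mathbf{F}\bm{\lambda}_i)$, $P(\bm{\lambda})=\sum_i p_i(\bm{\lambda}_i)$,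 $Q(\bm{\lambda})=\sum_i q_i(\bm{\lambda}_i)$ (the function $Q$ is distinct from the matrix $\mathbf{Q}$), and $\mathbf{M}=\mathbf{Q}^\top\otimes\mathbf{K}$ (the matrix $\mathbf{M}$ is distinct from the dimension $M$); $\mathbf{M}\bm{\lambda}=\mathbf{0}$ encodes $\mathbf{K}\bm{\lambda}_i=\mathbf{K}\bm{\lambda}_j$ for all $(i,j)\in E$. Lagrangian: $\mathcal{L}(\bm{\lambda},\bm{\xi})=P(\bm{\lambda})+Q(\bm{\lambda})+\bm{\xi}^\top\mathbf{M}\bm{\lambda}$, $\bm{\xi}\in\mathbb{R}^{|E|B}$. $C$ is the set of its saddle points, i.e. pairs $(\bm{\lambda}^*,\bm{\xi}^* )$ with $\mathcal{L}(\bm{\lambda},\bm{\xi}^* )\ge\mathcal{L}(\bm{\lambda}^*,\bm{\xi}^* )\ge\mathcal{L}(\bm{\lambda}^*,\bm{\xi})$ for all $\bm{\lambda},\bm{\xi}$; equivalently $\mathbf{0}\in\nabla P(\bm{\lambda}^* )+\partial Q(\bm{\lambda}^* )+\mathbf{M}^\top\bm{\xi}^*$ and $\mathbf{M}\bm{\lambda}^*=\mathbf{0}$. *)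

theory Defs
  imports "HOL-Analysis.Analysis"
begin

definition proper_fun :: "('a \<Rightarrow> ereal) \<Rightarrow> bool" where
  "proper_fun f \<longleftrightarrow> (\<forall>x. f x \<noteq> -\<infinity>) \<and> (\<exists>x. f x \<noteq> \<infinity>)"

definition epi :: "('a \<Rightarrow> ereal) \<Rightarrow> ('a \<times> real) set" where
  "epi f = {(x, r). f x \<le> ereal r}"

definition convex_fun :: "('a::real_vector \<Rightarrow> ereal) \<Rightarrow> bool" where
  "convex_fun f \<longleftrightarrow> convex (epi f)"

definition closed_fun :: "('a::topological_space \<Rightarrow> ereal) \<Rightarrow> bool" where
  "closed_fun f \<longleftrightarrow> closed (epi f)"

text \<open>The right-hand side below is \<open>\<infinity>\<close> as soon as one of the two points lies outside the
  effective domain, so for functions that avoid \<open>-\<infinity>\<close> only points of the domain matter.\<close>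

definition strongly_convex_fun :: "real \<Rightarrow> ('a::real_normed_vector \<Rightarrow> ereal) \<Rightarrow> bool" where
  "strongly_convex_fun \<sigma> f \<longleftrightarrow>
     (\<forall>x y t. 0 < t \<and> t < 1 \<longrightarrow>
        f ((1 - t) *\<^sub>R x + t *\<^sub>R y) + ereal (\<sigma> / 2 * t * (1 - t) * (norm (x - y))\<^sup>2)
          \<le> ereal (1 - t) * f x + ereal t * f y)"

text \<open>\<open>real_of_ereal\<close> sends infinite values to 0, hence the explicit finiteness near \<open>x\<close>.\<close>

definition has_gradient :: "('a::real_inner \<Rightarrow> ereal) \<Rightarrow> 'a \<Rightarrow> 'a \<Rightarrow> bool" where
  "has_gradient F d x \<longleftrightarrow>
     (\<forall>\<^sub>F y in nhds x. \<bar>F y\<bar> \<noteq> \<infinity>) \<and> GDERIV (\<lambda>y. real_of_ereal (F y)) x :> d"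

definition gradient :: "('a::real_inner \<Rightarrow> ereal) \<Rightarrow> 'a \<Rightarrow> 'a" where
  "gradient F x = (THE d. has_gradient F d x)"

text \<open>Differentiability is required at every point of the effective domain; for a function that is
  finite everywhere this is differentiability on the whole space.\<close>

definition differentiable_fun :: "('a::real_inner \<Rightarrow> ereal) \<Rightarrow> bool" where
  "differentiable_fun f \<longleftrightarrow> (\<forall>x. f x \<noteq> \<infinity> \<longrightarrow> (\<exists>d. has_gradient f d x))"

definition indicator_fun :: "'a set \<Rightarrow> 'a \<Rightarrow> ereal" where
  "indicator_fun S x = (if x \<in> S then 0 else \<infinity>)"

definition fenchel :: "('a::real_inner \<Rightarrow> ereal) \<Rightarrow> 'a \<Rightarrow> ereal" where
  "fenchel \<psi> v = (SUP u. ereal (v \<bullet> u) - \<psi> u)"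

definition prox :: "real \<Rightarrow> ('a::real_normed_vector \<Rightarrow> ereal) \<Rightarrow> 'a \<Rightarrow> 'a" where
  "prox \<alpha> \<psi> v = arg_min (\<lambda>u. \<psi> u + ereal (1 / (2 * \<alpha>) * (norm (u - v))\<^sup>2)) (\<lambda>_. True)"

text \<open>A stacked vector \<open>[v\<^sub>1; \<dots>; v\<^sub>N]\<close> with blocks indexed by \<open>'n\<close> is a vector over the index type
  \<open>'n \<times> 'c\<close>; the index type \<open>'b + 'm\<close> is used for vectors \<open>[\<theta>; \<mu>]\<close>.\<close>

definition block :: "'n::finite \<Rightarrow> real^('n \<times> 'c::finite) \<Rightarrow> real^'c" where
  "block i v = (\<chi> c. v $ (i, c))"

definition col_block :: "'n::finite \<Rightarrow> real^('n \<times> 'm::finite)^'b::finite \<Rightarrow> real^'m^'b" where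
  "col_block i A = (\<chi> r. block i (A $ r))"

definition hcat :: "real^'a::finite^'r::finite \<Rightarrow> real^'c::finite^'r \<Rightarrow> real^('a + 'c)^'r" where
  "hcat S T = (\<chi> r k. case k of Inl a \<Rightarrow> S $ r $ a | Inr c \<Rightarrow> T $ r $ c)"

definition spectral_norm :: "real^'c::finite^'r::finite \<Rightarrow> real" where
  "spectral_norm S = onorm ((*v) S)"

definition largest_eigenvalue :: "real^'c::finite^'c \<Rightarrow> real" where
  "largest_eigenvalue S = Max {\<tau>. \<exists>v. v \<noteq> 0 \<and> S *v v = \<tau> *\<^sub>R v}"

text \<open>The vertices \<open>1, \<dots>, N\<close> are the elements of a finite linearly ordered type.\<close>

definition simple_graph :: "'n set set \<Rightarrow> bool" where
  "simple_graph E \<longleftrightarrow> (\<forall>e\<in>E. card e = 2)"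

definition connected_graph :: "'n set set \<Rightarrow> bool" where
  "connected_graph E \<longleftrightarrow> (\<forall>i j. (i, j) \<in> {(u, v). {u, v} \<in> E}\<^sup>*)"

text \<open>The comprehension enumerates the pairs (smaller endpoint, larger endpoint) in lexicographic
  order, because its outer and inner loops both run over the vertices in increasing order.\<close>

definition edge_list :: "'n::{finite,linorder} set set \<Rightarrow> ('n \<times> 'n) list" where
  "edge_list E = [(i, j). i \<leftarrow> sorted_list_of_set UNIV, j \<leftarrow> sorted_list_of_set UNIV,
                          i < j \<and> {i, j} \<in> E]"

text \<open>Edge numbers range over \<open>{..<card E}\<close>. Since \<open>card E\<close> may be 0 and is not a type-level
  constant, matrices and vectors with an edge index are functions of which only the values at edge
  numbers below \<open>card E\<close> are ever used.\<close>

definition incidence :: "'n::{finite,linorder} set set \<Rightarrow> 'n \<Rightarrow> nat \<Rightarrow> real" where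
  "incidence E j k =
     (if j = fst (edge_list E ! k) then 1 else if j = snd (edge_list E ! k) then - 1 else 0)"

definition kron :: "('i \<Rightarrow> 'j \<Rightarrow> real) \<Rightarrow> ('k \<Rightarrow> 'l \<Rightarrow> real) \<Rightarrow> 'i \<times> 'k \<Rightarrow> 'j \<times> 'l \<Rightarrow> real" where
  "kron S T = (\<lambda>(i, k) (j, l). S i j * T k l)"

lemma set_edge_list: "set (edge_list E) = {(i, j). i < j \<and> {i, j} \<in> E}"
  by (auto simp: edge_list_def)

lemma distinct_edge_list: "distinct (edge_list E)"
proof -
  have *: "concat (map (\<lambda>j. if P j then [(i, j)] else []) xs) = map (Pair i) (filter P xs)"
    for i :: 'a and P and xs :: "'a list"
    by (induction xs) auto
  have **: "distinct (concat (map (\<lambda>i. map (Pair i) (filter (P i) ys)) xs))"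
    if "distinct xs" "distinct ys" for P and xs ys :: "'a list"
    using that by (induction xs) (auto simp: distinct_map inj_on_def)
  show ?thesis
    unfolding edge_list_def * by (rule **) simp_all
qed

lemma length_edge_list:
  assumes "simple_graph E"
  shows "length (edge_list E) = card E"
proof -
  have "bij_betw (\<lambda>(i, j). {i, j}) {(i, j). i < j \<and> {i, j} \<in> E} E"
  proof (rule bij_betwI')
    fix x y assume "x \<in> {(i, j). i < j \<and> {i, j} \<in> E}" "y \<in> {(i, j). i < j \<and> {i, j} \<in> E}"
    then show "((case x of (i, j) \<Rightarrow> {i, j}) = (case y of (i, j) \<Rightarrow> {i, j})) = (x = y)"
      by (auto simp: doubleton_eq_iff)
  next
    fix e assume "e \<in> E"
    then have "card e = 2"
      using assms by (auto simp: simple_graph_def)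
    then obtain i j where ij: "e = {i, j}" "i \<noteq> j"
      by (meson card_2_iff)
    show "\<exists>x\<in>{(i, j). i < j \<and> {i, j} \<in> E}. e = (case x of (i, j) \<Rightarrow> {i, j})"
    proof (cases "i < j")
      case True
      with ij \<open>e \<in> E\<close> show ?thesis by (intro bexI[of _ "(i, j)"]) auto
    next
      case False
      with ij have "j < i" by simp
      with ij \<open>e \<in> E\<close> show ?thesis by (intro bexI[of _ "(j, i)"]) (auto simp: insert_commute)
    qed
  qed auto
  then have "card {(i, j). i < j \<and> {i, j} \<in> E} = card E"
    by (rule bij_betw_same_card)
  then show ?thesis
    using distinct_card[OF distinct_edge_list[of E]] by (simp add: set_edge_list)
qed

definition H_mat :: "real^('n::finite \<times> 'm::finite)^'b::finite \<Rightarrow> 'n \<Rightarrow> real^('b + 'm)^'m" where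
  "H_mat A i = hcat (- transpose (col_block i A)) (- mat 1)"

definition F_mat :: "real^('b::finite + 'm::finite)^'m" where
  "F_mat = hcat 0 (mat 1)"

definition E_mat :: "real^'b::finite \<Rightarrow> real^('b + 'm::finite)^1" where
  "E_mat b = hcat (rowvector b) 0"

definition K_mat :: "real^('b::finite + 'm::finite)^'b" where
  "K_mat = hcat (mat 1) 0"

definition P_fun ::
  "('n::finite \<Rightarrow> real^'m::finite \<Rightarrow> ereal) \<Rightarrow> real^('n \<times> 'm)^'b::finite \<Rightarrow> real^'b \<Rightarrow> ('n \<Rightarrow> real)
    \<Rightarrow> real^('n \<times> ('b + 'm)) \<Rightarrow> ereal" where
  "P_fun f A b \<kappa> lam =
     (\<Sum>i\<in>UNIV. fenchel (f i) (H_mat A i *v block i lam)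
                 + ereal (\<kappa> i * (E_mat b *v block i lam) $ 1))"

definition Q_fun ::
  "('n::finite \<Rightarrow> real^'m::finite \<Rightarrow> ereal) \<Rightarrow> ('n \<Rightarrow> (real^'m) set)
    \<Rightarrow> real^('n \<times> ('b::finite + 'm)) \<Rightarrow> ereal" where
  "Q_fun g X lam =
     (\<Sum>i\<in>UNIV. fenchel (\<lambda>x. g i x + indicator_fun (X i) x) (F_mat *v block i lam))"

text \<open>\<open>M_mat E\<close> is the Kronecker product of the transposed incidence matrix with \<open>K_mat\<close>. Its rows
  are indexed by \<open>M_rows E\<close>, and a dual variable \<open>\<xi>\<close> is a function on these row indices.\<close>

definition M_rows :: "'n set set \<Rightarrow> (nat \<times> 'b) set" where
  "M_rows E = {..<card E} \<times> UNIV"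

definition M_mat ::
  "'n::{finite,linorder} set set \<Rightarrow> nat \<times> 'b::finite \<Rightarrow> 'n \<times> ('b + 'm::finite) \<Rightarrow> real" where
  "M_mat E = kron (\<lambda>k j. incidence E j k) (\<lambda>r c. K_mat $ r $ c)"

definition M_mult ::
  "'n::{finite,linorder} set set \<Rightarrow> real^('n \<times> ('b::finite + 'm::finite)) \<Rightarrow> nat \<times> 'b \<Rightarrow> real" where
  "M_mult E lam r = (\<Sum>c\<in>UNIV. M_mat E r c * lam $ c)"

definition MT_mult ::
  "'n::{finite,linorder} set set \<Rightarrow> (nat \<times> 'b::finite \<Rightarrow> real) \<Rightarrow> real^('n \<times> ('b + 'm::finite))" where
  "MT_mult E \<xi> = (\<chi> c. \<Sum>r\<in>M_rows E. M_mat E r c * \<xi> r)"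

definition MTM_mat ::
  "'n::{finite,linorder} set set \<Rightarrow>
    real^('n \<times> ('b::finite + 'm::finite))^('n \<times> ('b + 'm))" where
  "MTM_mat E = (\<chi> c d. \<Sum>r\<in>M_rows E. M_mat E r c * M_mat E r d)"

definition lagrangian ::
  "(real^('n::{finite,linorder} \<times> ('b::finite + 'm::finite)) \<Rightarrow> ereal)
    \<Rightarrow> (real^('n \<times> ('b + 'm)) \<Rightarrow> ereal) \<Rightarrow> 'n set set
    \<Rightarrow> real^('n \<times> ('b + 'm)) \<Rightarrow> (nat \<times> 'b \<Rightarrow> real) \<Rightarrow> ereal" where
  "lagrangian P Q E lam \<xi> = P lam + Q lam + ereal (\<Sum>r\<in>M_rows E. \<xi> r * M_mult E lam r)"

definition saddle_points :: "('a \<Rightarrow> 'c \<Rightarrow> ereal) \<Rightarrow> ('a \<times> 'c) set" where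
  "saddle_points L = {(ls, xs). \<forall>lam \<xi>. L lam xs \<ge> L ls xs \<and> L ls xs \<ge> L ls \<xi>}"

definition h_const ::
  "real^('n::finite \<times> 'm::finite)^'b::finite \<Rightarrow> ('n \<Rightarrow> real) \<Rightarrow> real" where
  "h_const A \<sigma> = (MAX i. (spectral_norm (H_mat A i))\<^sup>2 / \<sigma> i)"

definition ddpg_sequence ::
  "(real^('n::{finite,linorder} \<times> ('b::finite + 'm::finite)) \<Rightarrow> ereal)
    \<Rightarrow> (real^('n \<times> ('b + 'm)) \<Rightarrow> ereal) \<Rightarrow> 'n set set \<Rightarrow> real \<Rightarrow> real
    \<Rightarrow> (nat \<Rightarrow> real^('n \<times> ('b + 'm))) \<Rightarrow> (nat \<Rightarrow> nat \<times> 'b \<Rightarrow> real) \<Rightarrow> bool" where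
  "ddpg_sequence P Q E c \<gamma> lam \<xi> \<longleftrightarrow>
     (\<forall>t. lam (Suc t) =
            prox c Q (lam t - c *\<^sub>R (gradient P (lam t) + MT_mult E (\<xi> t)
                                      + \<gamma> *\<^sub>R (MTM_mat E *v lam t)))) \<and>
     (\<forall>t. \<forall>r\<in>M_rows E. \<xi> (Suc t) r = \<xi> t r + \<gamma> * M_mult E (lam (Suc t)) r)"

end

theory Submission
  imports Defs
begin

text \<open>Strong convexity of \<open>f\<^sub>i\<close> makes \<open>f\<^sub>i\<^sup>\<diamond>\<close> finite everywhere, with gradient the maximiser in the
  definition of the conjugate, and strongly monotone in that maximiser; hence \<open>\<nabla>P\<close> is
  \<open>1/h\<close>-cocoercive. Put \<open>D = I/c - \<gamma> M\<^sup>T M\<close>. Adding the subgradient inequality of \<open>Q\<close> at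
  the new iterate to the one at a saddle point \<open>(\<lambda>*, \<xi>*)\<close>, and using cocoercivity in the form
  \<open>\<langle>\<nabla>P(\<lambda>*) - \<nabla>P(\<lambda>), \<lambda>' - \<lambda>*\<rangle> \<le> h/4 \<parallel>\<lambda>' - \<lambda>\<parallel>\<^sup>2\<close>, shows that one step from \<open>(\<lambda>, \<xi>)\<close> to \<open>(\<lambda>', \<xi>')\<close>
  decreases \<open>V = \<parallel>\<lambda> - \<lambda>*\<parallel>\<^sub>D\<^sup>2 + \<parallel>\<xi> - \<xi>*\<parallel>\<^sup>2/\<gamma>\<close> by at least
  \<open>\<parallel>\<lambda>' - \<lambda>\<parallel>\<^sub>D\<^sup>2 - h/2 \<parallel>\<lambda>' - \<lambda>\<parallel>\<^sup>2 + \<parallel>\<xi>' - \<xi>\<parallel>\<^sup>2/\<gamma>\<close>. As \<open>D \<ge> h I\<close>, the iterates are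
  bounded with vanishing increments, every cluster point is a saddle point, and monotonicity of \<open>V\<close>
  with respect to that saddle point gives convergence of the whole sequence.\<close>

section \<open>Closed and convex extended-valued functions\<close>

text \<open>An infinite summand absorbs any deficit of the other bound, and two finite summands
  share the slack. The splitting supplies the neighbourhoods in
  \<open>closed_fun_add\<close>.\<close>

lemma real_less_ereal_add:
  assumes "x \<noteq> -\<infinity>" "y \<noteq> -\<infinity>" "ereal r < x + y"
  shows "\<exists>a b. ereal a < x \<and> ereal b < y \<and> r < a + b"
proof -
  have low: "\<exists>a. ereal a < z" if "z \<noteq> -\<infinity>" for z
    using that by (metis ereal_bot ereal_less_eq(2) linorder_not_le)
  consider "x = \<infinity>" | "y = \<infinity>" | u v where "x = ereal u" "y = ereal v"
    using assms by (cases x; cases y) auto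
  then show ?thesis
  proof cases
    case 1
    obtain b where "ereal b < y" using low assms by blast
    with 1 show ?thesis by (intro exI[of _ "r - b + 1"] exI[of _ b]) auto
  next
    case 2
    obtain a where "ereal a < x" using low assms by blast
    with 2 show ?thesis by (intro exI[of _ a] exI[of _ "r - a + 1"]) auto
  next
    case 3
    with assms have "r < u + v" by simp
    \<comment> \<open>Each bound gives up a third of the slack \<open>u + v - r\<close>; the
      remaining third keeps the inequality strict.\<close>
    with 3 show ?thesis
      by (intro exI[of _ "u - (u + v - r) / 3"] exI[of _ "v - (u + v - r) / 3"])
         (auto simp: field_simps)
  qed
qed

lemma sum_ereal_not_minf:
  fixes x :: "'i \<Rightarrow> ereal"
  assumes "\<And>i. i \<in> S \<Longrightarrow> x i \<noteq> -\<infinity>"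
  shows "(\<Sum>i\<in>S. x i) \<noteq> -\<infinity>"
  using assms by (induction S rule: infinite_finite_induct) auto

lemma proper_fun_real:
  assumes "proper_fun f"
  obtains x r where "f x = ereal r"
  using assms unfolding proper_fun_def by (metis ereal_cases)

section \<open>Closed functions, their sums and compositions\<close>

lemma closed_sublevel:
  fixes f :: "'a::topological_space \<Rightarrow> ereal"
  assumes "closed_fun f"
  shows "closed {x. f x \<le> ereal a}"
proof -
  have "{x. f x \<le> ereal a} = (\<lambda>x. (x, a)) -` epi f"
    by (auto simp: epi_def)
  then show ?thesis
    using assms unfolding closed_fun_def by (auto intro!: closed_vimage continuous_intros)
qed

lemma closed_fun_seq_limit:
  fixes f :: "'a::topological_space \<Rightarrow> ereal"
  assumes "closed_fun f" "x \<longlonglongrightarrow> l" "r \<longlonglongrightarrow> s" "\<And>n. f (x n) \<le> ereal (r n)"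
  shows "f l \<le> ereal s"
proof -
  have "(\<lambda>n. (x n, r n)) \<longlonglongrightarrow> (l, s)"
    using assms by (intro tendsto_Pair)
  moreover have "(x n, r n) \<in> epi f" for n
    using assms by (simp add: epi_def)
  ultimately have "(l, s) \<in> epi f"
    using assms(1) unfolding closed_fun_def
    by (intro Lim_in_closed_set[of "epi f" "\<lambda>n. (x n, r n)"]) auto
  then show ?thesis by (simp add: epi_def)
qed

text \<open>The complement of the epigraph is open: if \<open>r < f x + g x\<close>, suitable levels
  \<open>a < f x\<close> and \<open>b < g x\<close> with \<open>r < a + b\<close> still bound
  \<open>f\<close> and \<open>g\<close> below on the open complement of two closed sublevel
  sets.\<close>

lemma closed_fun_add:
  fixes f g :: "'a::topological_space \<Rightarrow> ereal"
  assumes "closed_fun f" "closed_fun g" "\<And>x. f x \<noteq> -\<infinity>" "\<And>x. g x \<noteq> -\<infinity>"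
  shows "closed_fun (\<lambda>x. f x + g x)"
  unfolding closed_fun_def closed_def
proof (subst open_subopen, intro ballI)
  fix z assume "z \<in> - epi (\<lambda>x. f x + g x)"
  then obtain x r where z: "z = (x, r)" and "ereal r < f x + g x"
    by (cases z) (auto simp: epi_def)
  then obtain a b where ab: "ereal a < f x" "ereal b < g x" "r < a + b"
    using real_less_ereal_add assms by metis
  define T where "T = ((- {y. f y \<le> ereal a}) \<inter> (- {y. g y \<le> ereal b})) \<times> {..<a + b}"
  have "open T"
    unfolding T_def
    by (intro open_Times open_Int open_Compl closed_sublevel assms open_lessThan)
  moreover have "z \<in> T"
    using ab z by (auto simp: T_def)
  moreover have "T \<subseteq> - epi (\<lambda>x. f x + g x)"
  proof
    fix w assume "w \<in> T"
    obtain y s where ys: "w = (y, s)" by (cases w)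
    with \<open>w \<in> T\<close> have w: "ereal a < f y" "ereal b < g y" "s < a + b"
      by (auto simp: T_def)
    then have "ereal s < ereal a + ereal b" by simp
    also have "\<dots> \<le> f y + g y"
      using w by (intro add_mono) auto
    finally show "w \<in> - epi (\<lambda>x. f x + g x)"
      using ys by (auto simp: epi_def)
  qed
  ultimately show "\<exists>T. open T \<and> z \<in> T \<and> T \<subseteq> - epi (\<lambda>x. f x + g x)" by blast
qed

lemma closed_fun_sum:
  fixes f :: "'i \<Rightarrow> 'a::topological_space \<Rightarrow> ereal"
  assumes "finite S" "\<And>i. closed_fun (f i)" "\<And>i x. f i x \<noteq> -\<infinity>"
  shows "closed_fun (\<lambda>x. \<Sum>i\<in>S. f i x)"
  using assms(1)
proof induction
  case empty
  have "epi (\<lambda>x::'a. 0) = UNIV \<times> {0..}"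
    by (auto simp: epi_def zero_ereal_def)
  then show ?case
    by (simp add: closed_fun_def closed_Times)
next
  case (insert i S)
  then show ?case
    using assms by (auto intro!: closed_fun_add simp: sum_ereal_not_minf)
qed

lemma closed_fun_add_continuous:
  fixes f :: "'a::topological_space \<Rightarrow> ereal"
  assumes "closed_fun f" "continuous_on UNIV k"
  shows "closed_fun (\<lambda>x. f x + ereal (k x))"
proof -
  have "epi (\<lambda>x. f x + ereal (k x)) = (\<lambda>(x, r). (x, r - k x)) -` epi f"
  proof -
    have "f x + ereal (k x) \<le> ereal r \<longleftrightarrow> f x \<le> ereal (r - k x)" for x r
      by (cases "f x") auto
    then show ?thesis by (auto simp: epi_def)
  qed
  moreover have "continuous_on UNIV (\<lambda>(x, r). (x, r - k x))"
    unfolding case_prod_beta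
    by (intro continuous_intros continuous_on_compose2[OF assms(2)]) auto
  ultimately show ?thesis
    using assms(1) unfolding closed_fun_def by (auto intro!: closed_vimage)
qed

lemma closed_fun_compose:
  fixes f :: "'a::topological_space \<Rightarrow> ereal"
  assumes "closed_fun f" "continuous_on UNIV k"
  shows "closed_fun (\<lambda>x. f (k x))"
proof -
  have "epi (\<lambda>x. f (k x)) = (\<lambda>(x, r). (k x, r)) -` epi f"
    by (auto simp: epi_def)
  moreover have "continuous_on UNIV (\<lambda>(x, r::real). (k x, r))"
    unfolding case_prod_beta
    by (intro continuous_intros continuous_on_compose2[OF assms(2)]) auto
  ultimately show ?thesis
    using assms(1) unfolding closed_fun_def by (auto intro!: closed_vimage)
qed

section \<open>Convex functions, with convexity expressed through real upper bounds\<close>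

lemma convex_funI:
  assumes "\<And>x y r s t. f x \<le> ereal r \<Longrightarrow> f y \<le> ereal s \<Longrightarrow> 0 < t \<Longrightarrow> t < 1 \<Longrightarrow>
    f ((1 - t) *\<^sub>R x + t *\<^sub>R y) \<le> ereal ((1 - t) * r + t * s)"
  shows "convex_fun f"
  unfolding convex_fun_def convex_alt
proof (intro ballI allI impI)
  fix z w and t :: real
  assume zw: "z \<in> epi f" "w \<in> epi f" and t: "0 \<le> t \<and> t \<le> 1"
  consider "t = 0" | "t = 1" | "0 < t" "t < 1" using t by linarith
  then show "(1 - t) *\<^sub>R z + t *\<^sub>R w \<in> epi f"
  proof cases
    case 3
    then show ?thesis
      using assms zw by (cases z; cases w) (auto simp: epi_def)
  qed (use zw in auto)
qed

lemma convex_funD: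
  assumes "convex_fun f" "f x \<le> ereal r" "f y \<le> ereal s" "0 \<le> t" "t \<le> 1"
  shows "f ((1 - t) *\<^sub>R x + t *\<^sub>R y) \<le> ereal ((1 - t) * r + t * s)"
proof -
  have "(1 - t) *\<^sub>R (x, r) + t *\<^sub>R (y, s) \<in> epi f"
    using assms unfolding convex_fun_def convex_alt by (auto simp: epi_def)
  then show ?thesis by (simp add: epi_def)
qed

lemma convex_fun_add:
  assumes "convex_fun f" "convex_fun g" "\<And>x. f x \<noteq> -\<infinity>" "\<And>x. g x \<noteq> -\<infinity>"
  shows "convex_fun (\<lambda>x. f x + g x)"
proof (rule convex_funI)
  fix x y r s and t :: real
  assume xy: "f x + g x \<le> ereal r" "f y + g y \<le> ereal s" and t: "0 < t" "t < 1"
  have "\<exists>a b. f x = ereal a \<and> g x = ereal b" if "f x + g x \<le> ereal r" for x r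
    using that assms(3,4)[of x] by (cases "f x"; cases "g x") auto
  then obtain a b a' b' where ab: "f x = ereal a" "g x = ereal b" "f y = ereal a'" "g y = ereal b'"
    using xy by meson
  have "f ((1 - t) *\<^sub>R x + t *\<^sub>R y) + g ((1 - t) *\<^sub>R x + t *\<^sub>R y)
      \<le> ereal ((1 - t) * a + t * a') + ereal ((1 - t) * b + t * b')"
    using ab t by (intro add_mono convex_funD assms) auto
  also have "\<dots> = ereal ((1 - t) * (a + b) + t * (a' + b'))"
    by (simp add: algebra_simps)
  also have "\<dots> \<le> ereal ((1 - t) * r + t * s)"
    using xy ab t by (auto intro!: add_mono mult_left_mono)
  finally show "f ((1 - t) *\<^sub>R x + t *\<^sub>R y) + g ((1 - t) *\<^sub>R x + t *\<^sub>R y)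
      \<le> ereal ((1 - t) * r + t * s)" .
qed

lemma convex_fun_sum:
  assumes "finite S" "\<And>i. convex_fun (f i)" "\<And>i x. f i x \<noteq> -\<infinity>"
  shows "convex_fun (\<lambda>x. \<Sum>i\<in>S. f i x)"
  using assms(1)
proof induction
  case empty
  show ?case
    by (rule convex_funI) (auto simp: zero_ereal_def)
next
  case (insert i S)
  then show ?case
    using assms by (auto intro!: convex_fun_add simp: sum_ereal_not_minf)
qed

lemma convex_fun_compose_linear:
  assumes "convex_fun f" "linear k"
  shows "convex_fun (\<lambda>x. f (k x))"
  by (rule convex_funI)
     (use assms in \<open>auto simp: linear_add linear_scale intro!: convex_funD\<close>)

lemma convex_fun_strongly_convex:
  assumes "strongly_convex_fun s f" "0 \<le> s"
  shows "convex_fun f"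
proof (rule convex_funI)
  fix x y r q and t :: real
  assume xy: "f x \<le> ereal r" "f y \<le> ereal q" and t: "0 < t" "t < 1"
  have "f ((1 - t) *\<^sub>R x + t *\<^sub>R y) + 0
      \<le> f ((1 - t) *\<^sub>R x + t *\<^sub>R y) + ereal (s / 2 * t * (1 - t) * (norm (x - y))\<^sup>2)"
    using assms(2) t by (intro add_left_mono) auto
  also have "\<dots> \<le> ereal (1 - t) * f x + ereal t * f y"
    using assms(1) t unfolding strongly_convex_fun_def by blast
  also have "\<dots> \<le> ereal (1 - t) * ereal r + ereal t * ereal q"
    using xy t by (intro add_mono ereal_mult_left_mono) auto
  finally show "f ((1 - t) *\<^sub>R x + t *\<^sub>R y) \<le> ereal ((1 - t) * r + t * q)" by simp
qed

section \<open>Strong convexity: quadratic perturbations, minimisers and growth\<close>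

lemma strongly_convex_fun_real:
  assumes "strongly_convex_fun s f" "f x = ereal a" "f y = ereal b" "0 < t" "t < 1"
  shows "f ((1 - t) *\<^sub>R x + t *\<^sub>R y)
    \<le> ereal ((1 - t) * a + t * b - s / 2 * t * (1 - t) * (norm (x - y))\<^sup>2)"
proof -
  have "f ((1 - t) *\<^sub>R x + t *\<^sub>R y) + ereal (s / 2 * t * (1 - t) * (norm (x - y))\<^sup>2)
      \<le> ereal (1 - t) * f x + ereal t * f y"
    using assms unfolding strongly_convex_fun_def by blast
  then show ?thesis
    using assms(2,3) by (cases "f ((1 - t) *\<^sub>R x + t *\<^sub>R y)") auto
qed

text \<open>A quadratic satisfies the strong convexity inequality with equality and the linear term
  is affine, so the moduli add. The case \<open>q = 0\<close> tilts a function for its conjugate,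
  the case \<open>s = 0\<close> covers proximal objectives.\<close>

lemma strongly_convex_fun_add_quadratic:
  fixes f :: "'a::real_inner \<Rightarrow> ereal"
  assumes "strongly_convex_fun s f" "\<And>x. f x \<noteq> -\<infinity>"
  shows "strongly_convex_fun (s + q) (\<lambda>x. f x + ereal (q / 2 * (norm (x - v))\<^sup>2 + w \<bullet> x))"
  unfolding strongly_convex_fun_def
proof (intro allI impI)
  fix x y :: 'a and t :: real assume t: "0 < t \<and> t < 1"
  let ?z = "(1 - t) *\<^sub>R x + t *\<^sub>R y"
  define k where "k x = q / 2 * (norm (x - v))\<^sup>2 + w \<bullet> x" for x :: 'a
  have k: "k ?z = (1 - t) * k x + t * k y - q / 2 * t * (1 - t) * (norm (x - y))\<^sup>2"
  proof -
    have e: "?z - v = (x - v) + t *\<^sub>R (y - x)" by (simp add: algebra_simps)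
    have "(norm (?z - v))\<^sup>2 = (1 - t) * (norm (x - v))\<^sup>2 + t * (norm (y - v))\<^sup>2
        - t * (1 - t) * (norm (x - y))\<^sup>2"
      unfolding power2_norm_eq_inner
      by (simp add: inner_diff_left inner_diff_right inner_add_left inner_add_right
          inner_commute algebra_simps)
    moreover have "w \<bullet> ?z = (1 - t) * (w \<bullet> x) + t * (w \<bullet> y)"
      by (simp only: inner_add_right inner_scaleR_right)
    ultimately show ?thesis
      unfolding k_def by algebra
  qed
  consider "f x = \<infinity>" | "f y = \<infinity>" | a b where "f x = ereal a" "f y = ereal b"
    using assms(2)[of x] assms(2)[of y] by (cases "f x"; cases "f y") auto
  then show "f ?z + ereal (q / 2 * (norm (?z - v))\<^sup>2 + w \<bullet> ?z)
          + ereal ((s + q) / 2 * t * (1 - t) * (norm (x - y))\<^sup>2)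
        \<le> ereal (1 - t) * (f x + ereal (q / 2 * (norm (x - v))\<^sup>2 + w \<bullet> x))
          + ereal t * (f y + ereal (q / 2 * (norm (y - v))\<^sup>2 + w \<bullet> y))"
    unfolding k_def[symmetric]
  proof cases
    case 3
    from strongly_convex_fun_real[OF assms(1) 3] t
    have "f ?z \<le> ereal ((1 - t) * a + t * b - s / 2 * t * (1 - t) * (norm (x - y))\<^sup>2)" by blast
    with assms(2)[of ?z] obtain d where d: "f ?z = ereal d"
        "d \<le> (1 - t) * a + t * b - s / 2 * t * (1 - t) * (norm (x - y))\<^sup>2"
      by (cases "f ?z") auto
    from d(2) show "f ?z + ereal (k ?z) + ereal ((s + q) / 2 * t * (1 - t) * (norm (x - y))\<^sup>2)
      \<le> ereal (1 - t) * (f x + ereal (k x)) + ereal t * (f y + ereal (k y))"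
      unfolding d(1) 3 k by (simp add: add_divide_distrib diff_divide_distrib algebra_simps)
  qed (use t assms(2)[of x] assms(2)[of y] in \<open>auto simp: ereal_mult_eq_PInfty\<close>)
qed

text \<open>Separate the point just below the graph at some \<open>x\<^sub>0\<close> from the epigraph; the separating
  hyperplane cannot be vertical because \<open>x\<^sub>0\<close> lies in the effective domain.\<close>

lemma affine_minorant:
  fixes f :: "'a::euclidean_space \<Rightarrow> ereal"
  assumes "proper_fun f" "convex_fun f" "closed_fun f"
  obtains a \<beta> where "\<And>x. ereal (a \<bullet> x + \<beta>) \<le> f x"
proof -
  obtain x0 r0 where x0: "f x0 = ereal r0"
    using assms(1) proper_fun_real by blast
  have "(x0, r0 - 1) \<notin> epi f" by (simp add: epi_def x0)
  then obtain z d where zd: "z \<bullet> (x0, r0 - 1) < d" "\<And>w. w \<in> epi f \<Longrightarrow> z \<bullet> w > d"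
    using separating_hyperplane_closed_point[of "epi f" "(x0, r0 - 1)"] assms(2,3)
    unfolding convex_fun_def closed_fun_def by blast
  obtain p s where z: "z = (p, s)" by (cases z)
  have "(x0, r0) \<in> epi f" by (simp add: epi_def x0)
  from zd(2)[OF this] zd(1) have s: "s > 0" by (simp add: z algebra_simps)
  have "ereal ((- inverse s *\<^sub>R p) \<bullet> x + d / s) \<le> f x" for x
  proof (cases "f x")
    case (real r)
    then have "(x, r) \<in> epi f" by (simp add: epi_def)
    from zd(2)[OF this] have "d < p \<bullet> x + s * r" by (simp add: z)
    with s real show ?thesis by (simp add: field_simps)
  next
    case MInf
    then show ?thesis using assms(1) by (auto simp: proper_fun_def)
  qed auto
  then show ?thesis by (rule that)
qed

text \<open>At the midpoint of \<open>x0\<close> and \<open>x\<close>, strong convexity pushes the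
  value down by an amount quadratic in \<open>norm (x - x0)\<close>, while an affine minorant allows
  only a linear drop; hence sublevel sets are bounded, and on a bounded set the minorant is bounded
  below.\<close>

lemma strongly_convex_fun_coercive:
  fixes f :: "'a::euclidean_space \<Rightarrow> ereal"
  assumes "proper_fun f" "closed_fun f" "strongly_convex_fun s f" "s > 0"
  shows "bounded {x. f x \<le> ereal r}" and "\<exists>L. \<forall>x. f x \<le> ereal r \<longrightarrow> ereal L \<le> f x"
proof -
  obtain a \<beta> where minor: "\<And>x. ereal (a \<bullet> x + \<beta>) \<le> f x"
    using affine_minorant[of f] convex_fun_strongly_convex assms by (metis less_imp_le)
  obtain x0 r0 where x0: "f x0 = ereal r0"
    using assms(1) proper_fun_real by blast
  \<comment> \<open>\<open>k\<close> collects the terms free of \<open>x - x0\<close>. The 1 in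
    \<open>B\<close> covers the unit ball around \<open>x0\<close>, the fraction is the bound
    obtained outside it.\<close>
  define k where "k = r + r0 - 2 * (a \<bullet> x0 + \<beta>)"
  define B where "B = 1 + 4 * (\<bar>k\<bar> + norm a) / s"
  have B: "norm (x - x0) \<le> B" if le: "f x \<le> ereal r" for x
  proof (cases "norm (x - x0) \<le> 1")
    case True
    then show ?thesis using assms(4) by (auto simp: B_def intro: add_increasing2)
  next
    case False
    let ?z = "(1 - 1/2) *\<^sub>R x0 + (1/2) *\<^sub>R x"
    let ?n = "norm (x - x0)"
    obtain q where q: "f x = ereal q" "q \<le> r"
      using le assms(1) by (cases "f x") (auto simp: proper_fun_def)
    have "ereal (a \<bullet> ?z + \<beta>) \<le> f ?z" by (rule minor)
    also have "\<dots> \<le> ereal ((1 - 1/2) * r0 + 1/2 * q - s / 2 * (1/2) * (1 - 1/2) * (norm (x0 - x))\<^sup>2)"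
      by (rule strongly_convex_fun_real[OF assms(3) x0 q(1)]) auto
    finally have "s / 4 * ?n\<^sup>2 \<le> r0 + q - 2 * \<beta> - a \<bullet> x0 - a \<bullet> x"
      by (simp add: inner_add_right norm_minus_commute field_simps)
    also have "\<dots> \<le> k - a \<bullet> (x - x0)"
      using q by (simp add: k_def inner_diff_right)
    also have "\<dots> \<le> \<bar>k\<bar> * ?n + norm a * ?n"
      using Cauchy_Schwarz_ineq2[of a "x - x0"] False mult_left_mono[of 1 ?n "\<bar>k\<bar>"] by auto
    finally have "(s / 4 * ?n) * ?n \<le> (\<bar>k\<bar> + norm a) * ?n"
      by (simp add: power2_eq_square algebra_simps)
    then have "s / 4 * ?n \<le> \<bar>k\<bar> + norm a"
      by (rule mult_right_le_imp_le) (use False in linarith)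
    then show ?thesis
      using assms(4) by (simp add: B_def field_simps)
  qed
  then have "{x. f x \<le> ereal r} \<subseteq> cball x0 B"
    by (auto simp: dist_norm norm_minus_commute)
  then show "bounded {x. f x \<le> ereal r}"
    using bounded_cball bounded_subset by blast
  have "ereal (a \<bullet> x0 + \<beta> - norm a * B) \<le> f x" if "f x \<le> ereal r" for x
  proof -
    have "norm a * norm (x - x0) \<le> norm a * B"
      using B[OF that] by (intro mult_left_mono) auto
    then have "a \<bullet> x0 + \<beta> - norm a * B \<le> a \<bullet> x + \<beta>"
      using Cauchy_Schwarz_ineq2[of a "x - x0"] by (auto simp: inner_diff_right)
    then show ?thesis
      using minor[of x] by (intro order_trans[OF _ minor[of x]]) simp
  qed
  then show "\<exists>L. \<forall>x. f x \<le> ereal r \<longrightarrow> ereal L \<le> f x" by blast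
qed

text \<open>By coercivity the part of the epigraph up to a finite level \<open>r0\<close> is
  compact. Minimising the continuous height \<open>snd\<close> over it replaces continuity of
  \<open>f\<close>.\<close>

lemma strongly_convex_fun_attains_min:
  fixes f :: "'a::euclidean_space \<Rightarrow> ereal"
  assumes "proper_fun f" "closed_fun f" "strongly_convex_fun s f" "s > 0"
  obtains u where "\<And>y. f u \<le> f y"
proof -
  obtain x0 r0 where x0: "f x0 = ereal r0"
    using assms(1) proper_fun_real by blast
  obtain L where L: "\<And>x. f x \<le> ereal r0 \<Longrightarrow> ereal L \<le> f x"
    using strongly_convex_fun_coercive(2)[OF assms] by metis
  define K where "K = epi f \<inter> (UNIV \<times> {..r0})"
  have "K \<subseteq> {x. f x \<le> ereal r0} \<times> {L..r0}"
  proof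
    fix z assume "z \<in> K"
    then obtain x r where z: "z = (x, r)" "f x \<le> ereal r" "r \<le> r0"
      by (auto simp: K_def epi_def)
    moreover from z have "f x \<le> ereal r0"
      using order_trans[of "f x" "ereal r" "ereal r0"] by simp
    moreover from L[OF this] z have "ereal L \<le> ereal r" using order_trans by blast
    ultimately show "z \<in> {x. f x \<le> ereal r0} \<times> {L..r0}" by simp
  qed
  then have "bounded K"
    using bounded_subset[OF bounded_Times[OF strongly_convex_fun_coercive(1)[OF assms]]]
      bounded_closed_interval by blast
  moreover have "closed K"
    using assms(2) unfolding K_def closed_fun_def by (intro closed_Int closed_Times) auto
  ultimately have "compact K" using compact_eq_bounded_closed by blast
  moreover have "(x0, r0) \<in> K" using x0 by (simp add: K_def epi_def)
  ultimately obtain z where z: "z \<in> K" "\<And>w. w \<in> K \<Longrightarrow> snd z \<le> snd w"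
    using continuous_attains_inf[of K snd] continuous_on_snd[OF continuous_on_id] by blast
  obtain u r where ur: "z = (u, r)" by (cases z)
  have u: "f u \<le> ereal r" "r \<le> r0" using z(1) ur by (auto simp: K_def epi_def)
  have "f u \<le> f y" for y
  proof (cases "f y \<le> ereal r0")
    case True
    then obtain q where q: "f y = ereal q"
      using assms(1) by (cases "f y") (auto simp: proper_fun_def)
    with True have "(y, q) \<in> K" by (simp add: K_def epi_def)
    from z(2)[OF this] ur have "r \<le> q" by simp
    with u q show ?thesis
      using order_trans[of "f u" "ereal r" "ereal q"] by simp
  next
    case False
    then have "ereal r \<le> f y"
      using u(2) order_trans[of "ereal r" "ereal r0" "f y"] by simp
    with u(1) show ?thesis by (rule order_trans)
  qed
  then show ?thesis by (rule that)
qed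

text \<open>Strong convexity on the segment from the minimiser \<open>u\<close> to \<open>y\<close>
  gives, after division by \<open>t\<close>, growth with the factor \<open>1 - t\<close>; letting
  \<open>t\<close> tend to 0 removes the factor.\<close>

lemma strongly_convex_fun_quadratic_growth:
  fixes f :: "'a::real_normed_vector \<Rightarrow> ereal"
  assumes "proper_fun f" "strongly_convex_fun s f" "\<And>y. f u \<le> f y"
  shows "f u + ereal (s / 2 * (norm (y - u))\<^sup>2) \<le> f y"
proof (cases "f y")
  case (real b)
  then obtain a where a: "f u = ereal a"
    using assms(1) assms(3)[of y] by (cases "f u") (auto simp: proper_fun_def)
  have *: "a + s / 2 * (1 - t) * (norm (y - u))\<^sup>2 \<le> b" if "0 < t" "t < 1" for t
  proof -
    have "ereal a \<le> f ((1 - t) *\<^sub>R u + t *\<^sub>R y)" using assms(3) a by metis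
    also have "\<dots> \<le> ereal ((1 - t) * a + t * b - s / 2 * t * (1 - t) * (norm (u - y))\<^sup>2)"
      by (rule strongly_convex_fun_real[OF assms(2) a real that])
    finally have "t * (a + s / 2 * (1 - t) * (norm (y - u))\<^sup>2) \<le> t * b"
      by (simp add: norm_minus_commute algebra_simps)
    with that show ?thesis by simp
  qed
  have "((\<lambda>t. a + s / 2 * (1 - t) * (norm (y - u))\<^sup>2) \<longlongrightarrow> a + s / 2 * (1 - 0) * (norm (y - u))\<^sup>2) (at_right 0)"
    by (intro tendsto_intros)
  moreover have "\<forall>\<^sub>F t in at_right 0. a + s / 2 * (1 - t) * (norm (y - u))\<^sup>2 \<le> b"
    using * by (auto simp: eventually_at_right_field intro!: exI[of _ 1])
  ultimately have "a + s / 2 * (norm (y - u))\<^sup>2 \<le> b"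
    using tendsto_upperbound[of _ _ "at_right (0::real)" b] by fastforce
  then show ?thesis by (simp add: a real)
next
  case MInf
  then show ?thesis using assms(1) by (auto simp: proper_fun_def)
qed auto

section \<open>Conjugates, gradients and proximal maps\<close>

text \<open>The epigraph of a supremum is an intersection: a finite \<open>\<psi> u\<close>
  contributes a closed half-space, an infinite one everything or nothing.\<close>

lemma closed_fun_fenchel: "closed_fun (fenchel \<psi>)"
proof -
  have "epi (fenchel \<psi>) = (\<Inter>u. {(v, r). ereal (v \<bullet> u) - \<psi> u \<le> ereal r})"
    by (auto simp: epi_def fenchel_def SUP_le_iff)
  moreover have "closed {(v, r). ereal (v \<bullet> u) - \<psi> u \<le> ereal r}" for u
  proof (cases "\<psi> u")
    case (real q)
    then have "{(v, r). ereal (v \<bullet> u) - \<psi> u \<le> ereal r} = {z. fst z \<bullet> u - q \<le> snd z}"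
      by auto
    moreover have "closed {z. fst z \<bullet> u - q \<le> snd z}"
      by (intro closed_Collect_le continuous_intros)
    ultimately show ?thesis by simp
  qed auto
  ultimately show ?thesis
    unfolding closed_fun_def by auto
qed

lemma convex_fun_fenchel: "convex_fun (fenchel \<psi>)"
proof (rule convex_funI)
  fix x y r s and t :: real
  assume xy: "fenchel \<psi> x \<le> ereal r" "fenchel \<psi> y \<le> ereal s" and t: "0 < t" "t < 1"
  show "fenchel \<psi> ((1 - t) *\<^sub>R x + t *\<^sub>R y) \<le> ereal ((1 - t) * r + t * s)"
    unfolding fenchel_def
  proof (rule SUP_least)
    fix u
    have u: "ereal (x \<bullet> u) - \<psi> u \<le> ereal r" "ereal (y \<bullet> u) - \<psi> u \<le> ereal s"
      using xy by (auto simp: fenchel_def SUP_le_iff)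
    show "ereal (((1 - t) *\<^sub>R x + t *\<^sub>R y) \<bullet> u) - \<psi> u \<le> ereal ((1 - t) * r + t * s)"
    proof (cases "\<psi> u")
      case (real q)
      with u have "(1 - t) * (x \<bullet> u - q) + t * (y \<bullet> u - q) \<le> (1 - t) * r + t * s"
        using t by (intro add_mono mult_left_mono) auto
      with real show ?thesis by (simp add: inner_add_left algebra_simps)
    qed (use u in auto)
  qed
qed

lemma fenchel_not_minf:
  assumes "\<psi> x \<noteq> \<infinity>"
  shows "fenchel \<psi> v \<noteq> -\<infinity>"
proof
  assume "fenchel \<psi> v = -\<infinity>"
  then have "ereal (v \<bullet> x) - \<psi> x \<le> -\<infinity>"
    unfolding fenchel_def by (metis SUP_upper UNIV_I)
  with assms show False by (cases "\<psi> x") auto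
qed

text \<open>An affine minorant with slope \<open>a\<close> and intercept \<open>\<beta>\<close>
  bounds the conjugate at \<open>a\<close> by \<open>- \<beta>\<close>.\<close>

lemma proper_fun_fenchel:
  fixes \<psi> :: "'a::euclidean_space \<Rightarrow> ereal"
  assumes "proper_fun \<psi>" "convex_fun \<psi>" "closed_fun \<psi>"
  shows "proper_fun (fenchel \<psi>)"
proof -
  obtain a \<beta> where minor: "\<And>x. ereal (a \<bullet> x + \<beta>) \<le> \<psi> x"
    using affine_minorant assms by blast
  have "fenchel \<psi> a \<le> ereal (- \<beta>)"
    unfolding fenchel_def
  proof (rule SUP_least)
    fix u show "ereal (a \<bullet> u) - \<psi> u \<le> ereal (- \<beta>)"
      using minor[of u] by (cases "\<psi> u") auto
  qed
  then have "fenchel \<psi> a \<noteq> \<infinity>" by auto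
  with fenchel_not_minf assms(1) show ?thesis
    unfolding proper_fun_def by metis
qed

text \<open>The gradient of the conjugate at \<open>v\<close> is the maximiser \<open>U v\<close> of \<open>v \<bullet> u - \<psi> u\<close>; adding the
  quadratic growth inequalities at two maximisers gives strong monotonicity in \<open>U\<close>.\<close>

lemma fenchel_strongly_convex:
  fixes \<psi> :: "'a::euclidean_space \<Rightarrow> ereal"
  assumes "proper_fun \<psi>" "closed_fun \<psi>" "strongly_convex_fun s \<psi>" "s > 0"
  obtains \<phi> U where "\<And>v. fenchel \<psi> v = ereal (\<phi> v)"
    "\<And>v w. \<phi> v + U v \<bullet> (w - v) \<le> \<phi> w"
    "\<And>v w. s * (norm (U v - U w))\<^sup>2 \<le> (U v - U w) \<bullet> (v - w)"
proof -
  have "\<exists>u r. \<psi> u = ereal r \<and> (\<forall>y. ereal (r + v \<bullet> (y - u) + s / 2 * (norm (y - u))\<^sup>2) \<le> \<psi> y)" for v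
  proof -
    \<comment> \<open>Minimisers of \<open>F\<close> are maximisers of
      \<open>v \<bullet> u - \<psi> u\<close>. The vanishing quadratic keeps \<open>F\<close> in the
      form of \<open>strongly_convex_fun_add_quadratic\<close> with \<open>q = 0\<close>.\<close>
    define F where "F x = \<psi> x + ereal (0 / 2 * (norm (x - 0))\<^sup>2 + (- v) \<bullet> x)" for x
    have sc: "strongly_convex_fun s F"
      using strongly_convex_fun_add_quadratic[OF assms(3), of 0 0 "- v"] assms(1)
      by (simp add: F_def[abs_def] proper_fun_def)
    have pr: "proper_fun F"
      using assms(1) by (auto simp: F_def proper_fun_def)
    have cl: "closed_fun F"
      unfolding F_def by (intro closed_fun_add_continuous assms continuous_intros)
    obtain u where u: "\<And>y. F u \<le> F y"
      using strongly_convex_fun_attains_min[OF pr cl sc assms(4)] by blast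
    obtain x0 r0 where x0: "F x0 = ereal r0"
      using pr proper_fun_real by blast
    from u[of x0] pr obtain r where "F u = ereal r"
      unfolding proper_fun_def by (cases "F u") (auto simp: x0)
    then have r: "\<psi> u = ereal (r + v \<bullet> u)"
      by (cases "\<psi> u") (auto simp: F_def)
    have "ereal (r + v \<bullet> u + v \<bullet> (y - u) + s / 2 * (norm (y - u))\<^sup>2) \<le> \<psi> y" for y
      using strongly_convex_fun_quadratic_growth[OF pr sc u, of y] r
      by (cases "\<psi> y") (auto simp: F_def algebra_simps)
    with r show ?thesis by blast
  qed
  then obtain U \<rho> where U: "\<And>v. \<psi> (U v) = ereal (\<rho> v)"
      "\<And>v y. ereal (\<rho> v + v \<bullet> (y - U v) + s / 2 * (norm (y - U v))\<^sup>2) \<le> \<psi> y"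
    by metis
  have U': "\<rho> v + v \<bullet> (U w - U v) + s / 2 * (norm (U w - U v))\<^sup>2 \<le> \<rho> w" for v w
    using U(2)[of v "U w"] U(1) by simp
  have "fenchel \<psi> v = ereal (v \<bullet> U v - \<rho> v)" for v
    unfolding fenchel_def
  proof (rule antisym)
    show "(SUP u. ereal (v \<bullet> u) - \<psi> u) \<le> ereal (v \<bullet> U v - \<rho> v)"
    proof (rule SUP_least)
      fix u
      have "ereal (\<rho> v + v \<bullet> (u - U v)) \<le> ereal (\<rho> v + v \<bullet> (u - U v) + s / 2 * (norm (u - U v))\<^sup>2)"
        using assms(4) by simp
      also note U(2)
      finally show "ereal (v \<bullet> u) - \<psi> u \<le> ereal (v \<bullet> U v - \<rho> v)"
        by (cases "\<psi> u") (auto simp: inner_diff_right)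
    qed
    show "ereal (v \<bullet> U v - \<rho> v) \<le> (SUP u. ereal (v \<bullet> u) - \<psi> u)"
      by (rule SUP_upper2[of "U v"]) (auto simp: U)
  qed
  moreover have "v \<bullet> U v - \<rho> v + U v \<bullet> (w - v) \<le> w \<bullet> U w - \<rho> w" for v w
  proof -
    have "0 \<le> s / 2 * (norm (U v - U w))\<^sup>2" using assms(4) by simp
    with U'[of w v] show ?thesis
      by (simp add: inner_diff_right inner_commute)
  qed
  moreover have "s * (norm (U v - U w))\<^sup>2 \<le> (U v - U w) \<bullet> (v - w)" for v w
    using U'[of v w] U'[of w v]
    by (simp add: inner_diff_right inner_diff_left inner_commute norm_minus_commute)
  ultimately show ?thesis by (rule that)
qed

text \<open>A quadratic error bound implies Frechet differentiability, and uniqueness of the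
  derivative resolves the \<open>THE\<close> in \<open>gradient\<close>.\<close>

lemma gradient_eqI:
  assumes "\<And>y. F y = ereal (p y)" "\<And>y. \<bar>p y - p x - d \<bullet> (y - x)\<bar> \<le> K * (norm (y - x))\<^sup>2"
  shows "gradient F x = d"
proof -
  have "(p has_derivative (\<lambda>h. h \<bullet> d)) (at x)"
  proof (rule has_derivativeI_sandwich[of 1])
    show "((\<lambda>y. K * norm (y - x)) \<longlongrightarrow> 0) (at x)"
      by (auto intro!: tendsto_eq_intros)
    fix y assume "y \<noteq> x"
    then show "norm (p y - p x - (y - x) \<bullet> d) / norm (y - x) \<le> K * norm (y - x)"
      using assms(2)[of y] by (simp add: divide_le_eq power2_eq_square inner_commute mult.assoc)
  qed (auto intro: bounded_linear_inner_left)
  then have d: "GDERIV p x :> d" by (simp add: gderiv_def)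
  have F: "(\<lambda>y. real_of_ereal (F y)) = p" by (simp add: assms(1))
  show ?thesis
    unfolding gradient_def
  proof (rule the_equality)
    show "has_gradient F d x"
      using d by (simp add: has_gradient_def F) (simp add: assms(1))
    fix d' assume "has_gradient F d' x"
    then have "(p has_derivative (\<lambda>h. h \<bullet> d')) (at x)"
      by (simp add: has_gradient_def F gderiv_def)
    with d have "(\<lambda>h. h \<bullet> d') = (\<lambda>h. h \<bullet> d)"
      unfolding gderiv_def by (metis has_derivative_unique)
    then show "d' = d" by (metis vector_eq_ldot)
  qed
qed

text \<open>Quadratic growth of the strongly convex prox objective at its minimiser, rewritten by
  the three-point identity \<open>N\<close>. It says that
  \<open>(v - prox \<alpha> \<psi> v) / \<alpha>\<close> is a subgradient of \<open>\<psi>\<close>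
  at the proximal point.\<close>

lemma prox_inequality:
  fixes \<psi> :: "'a::euclidean_space \<Rightarrow> ereal"
  assumes "proper_fun \<psi>" "convex_fun \<psi>" "closed_fun \<psi>" "\<alpha> > 0"
  shows "\<psi> (prox \<alpha> \<psi> v) + ereal ((1 / \<alpha>) * ((v - prox \<alpha> \<psi> v) \<bullet> (y - prox \<alpha> \<psi> v))) \<le> \<psi> y"
proof -
  define F where "F u = \<psi> u + ereal (1 / (2 * \<alpha>) * (norm (u - v))\<^sup>2)" for u
  define u where "u = prox \<alpha> \<psi> v"
  have nm: "\<psi> x \<noteq> -\<infinity>" for x using assms(1) by (simp add: proper_fun_def)
  \<comment> \<open>Convexity is strong convexity with modulus 0, so the quadratic alone supplies
    the modulus \<open>1 / \<alpha>\<close>.\<close>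
  have "strongly_convex_fun 0 \<psi>"
    unfolding strongly_convex_fun_def
  proof (intro allI impI)
    fix x y and t :: real assume t: "0 < t \<and> t < 1"
    consider "\<psi> x = \<infinity>" | "\<psi> y = \<infinity>" | a b where "\<psi> x = ereal a" "\<psi> y = ereal b"
      using nm[of x] nm[of y] by (cases "\<psi> x"; cases "\<psi> y") auto
    then show "\<psi> ((1 - t) *\<^sub>R x + t *\<^sub>R y) + ereal (0 / 2 * t * (1 - t) * (norm (x - y))\<^sup>2)
        \<le> ereal (1 - t) * \<psi> x + ereal t * \<psi> y"
    proof cases
      case 3
      then show ?thesis
        using convex_funD[OF assms(2), of x a y b t] t by simp
    qed (use t nm[of x] nm[of y] in \<open>auto simp: ereal_mult_eq_PInfty\<close>)
  qed
  from strongly_convex_fun_add_quadratic[OF this nm, of "1 / \<alpha>" v 0]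
  have sc: "strongly_convex_fun (1 / \<alpha>) F" by (simp add: F_def[abs_def] mult.commute)
  have pr: "proper_fun F" using assms(1) by (auto simp: F_def proper_fun_def)
  have cl: "closed_fun F"
    unfolding F_def by (intro closed_fun_add_continuous assms continuous_intros)
  obtain u0 where "\<And>y. F u0 \<le> F y"
    using strongly_convex_fun_attains_min[OF pr cl sc] assms(4) by auto
  then have "is_arg_min F (\<lambda>_. True) u0" by (auto simp: is_arg_min_def not_less)
  then have "is_arg_min F (\<lambda>_. True) u"
    unfolding u_def prox_def arg_min_def F_def[symmetric] by (rule someI)
  then have u: "F u \<le> F y" for y by (auto simp: is_arg_min_def not_less)
  have N: "(norm (y - v))\<^sup>2 = (norm (y - u))\<^sup>2 + (norm (u - v))\<^sup>2 - 2 * ((v - u) \<bullet> (y - u))"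
    unfolding power2_norm_eq_inner
    by (simp add: inner_diff_left inner_diff_right inner_commute)
  have id: "1 / (2 * \<alpha>) * (norm (u - v))\<^sup>2 + 1 / \<alpha> / 2 * (norm (y - u))\<^sup>2
      - 1 / (2 * \<alpha>) * (norm (y - v))\<^sup>2 = 1 / \<alpha> * ((v - u) \<bullet> (y - u))"
    unfolding N using assms(4) by (simp add: field_simps)
  have "F u + ereal (1 / \<alpha> / 2 * (norm (y - u))\<^sup>2) \<le> F y"
    by (rule strongly_convex_fun_quadratic_growth[OF pr sc u])
  then show ?thesis
    unfolding u_def[symmetric] id[symmetric] F_def
    using nm[of u] nm[of y] by (cases "\<psi> u"; cases "\<psi> y") auto
qed

section \<open>The largest eigenvalue of a symmetric matrix\<close>

text \<open>Eigenvectors of distinct eigenvalues are orthogonal, and orthogonal sets in finite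
  dimension are finite. Finiteness gives the \<open>Max\<close> in \<open>largest_eigenvalue\<close>
  its meaning.\<close>

lemma finite_eigenvalues_symmetric:
  fixes S :: "real^'c::finite^'c"
  assumes "transpose S = S"
  shows "finite {\<tau>. \<exists>v. v \<noteq> 0 \<and> S *v v = \<tau> *\<^sub>R v}" (is "finite ?T")
proof -
  define e where "e \<tau> = (SOME v. v \<noteq> 0 \<and> S *v v = \<tau> *\<^sub>R v)" for \<tau>
  have e: "e \<tau> \<noteq> 0 \<and> S *v e \<tau> = \<tau> *\<^sub>R e \<tau>" if "\<tau> \<in> ?T" for \<tau>
    using that unfolding e_def mem_Collect_eq by (rule someI_ex)
  have orth: "e \<tau> \<bullet> e \<tau>' = 0" if "\<tau> \<in> ?T" "\<tau>' \<in> ?T" "\<tau> \<noteq> \<tau>'" for \<tau> \<tau>'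
  proof -
    have "(S *v e \<tau>) \<bullet> e \<tau>' = e \<tau> \<bullet> (S *v e \<tau>')"
      by (metis assms dot_lmul_matrix vector_transpose_matrix)
    with e that have "\<tau> * (e \<tau> \<bullet> e \<tau>') = \<tau>' * (e \<tau> \<bullet> e \<tau>')" by simp
    with that show ?thesis by simp
  qed
  have "inj_on e ?T"
  proof (rule inj_onI, rule ccontr)
    fix \<tau> \<tau>' assume "\<tau> \<in> ?T" "\<tau>' \<in> ?T" "e \<tau> = e \<tau>'" "\<tau> \<noteq> \<tau>'"
    with orth[of \<tau> \<tau>'] e[of \<tau>] show False by simp
  qed
  moreover have "pairwise orthogonal (e ` ?T)"
    using orth by (auto simp: pairwise_def orthogonal_def)
  then have "finite (e ` ?T)"
    using pairwise_orthogonal_imp_finite by blast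
  ultimately show ?thesis using finite_imageD by blast
qed

text \<open>A maximiser \<open>u\<close> of the Rayleigh quotient on the unit sphere is an
  eigenvector, so the maximum \<open>T\<close> is an eigenvalue and at most the largest one.\<close>

lemma largest_eigenvalue_symmetric:
  fixes S :: "real^'c::finite^'c"
  assumes "transpose S = S"
  shows "v \<bullet> (S *v v) \<le> largest_eigenvalue S * (norm v)\<^sup>2"
proof -
  have sym: "(S *v x) \<bullet> y = x \<bullet> (S *v y)" for x y
    by (metis assms dot_lmul_matrix vector_transpose_matrix)
  have "continuous_on (sphere 0 1) (\<lambda>x. x \<bullet> (S *v x))"
    by (intro continuous_intros linear_continuous_on matrix_vector_mul_bounded_linear)
  moreover have "compact (sphere (0::real^'c) 1)" "sphere (0::real^'c) 1 \<noteq> {}"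
    by auto
  ultimately obtain u where u: "norm u = 1" and umax: "\<And>x. norm x = 1 \<Longrightarrow> x \<bullet> (S *v x) \<le> u \<bullet> (S *v u)"
    using continuous_attains_sup[of "sphere (0::real^'c) 1" "\<lambda>x. x \<bullet> (S *v x)"]
    by (metis mem_sphere_0)
  define T where "T = u \<bullet> (S *v u)"
  have T: "x \<bullet> (S *v x) \<le> T * (norm x)\<^sup>2" for x
  proof (cases "x = 0")
    case False
    let ?y = "inverse (norm x) *\<^sub>R x"
    have "?y \<bullet> (S *v ?y) \<le> T"
      unfolding T_def using False by (intro umax) simp
    moreover have "?y \<bullet> (S *v ?y) = (x \<bullet> (S *v x)) / (norm x)\<^sup>2"
      by (simp add: matrix_vector_mult_scaleR power2_eq_square divide_inverse)
    ultimately show ?thesis using False by (simp add: divide_le_eq)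
  qed simp
  \<comment> \<open>\<open>z\<close> is the residual of the eigenvalue equation at \<open>u\<close>,
    and \<open>q\<close> the value at \<open>z\<close> of the positive semidefinite form of
    \<open>T I - S\<close>.\<close>
  define z where "z = T *\<^sub>R u - S *v u"
  define q where "q = T * (z \<bullet> z) - z \<bullet> (S *v z)"
  have q: "q \<ge> 0" using T[of z] by (simp add: q_def power2_norm_eq_inner)
  \<comment> \<open>The form of \<open>T I - S\<close> vanishes at \<open>u\<close> and is
    nonnegative at \<open>u - t z\<close>; its expansion in \<open>t\<close> is this
    inequality.\<close>
  have *: "2 * t * (z \<bullet> z) \<le> t * t * q" for t
  proof -
    have uu: "u \<bullet> u = 1" using u by (simp add: norm_eq_1)
    have zz: "z \<bullet> z = T * (z \<bullet> u) - z \<bullet> (S *v u)"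
      using inner_diff_right[of z "T *\<^sub>R u" "S *v u"] unfolding z_def[symmetric] by simp
    have "(u - t *\<^sub>R z) \<bullet> (S *v (u - t *\<^sub>R z)) \<le> T * (norm (u - t *\<^sub>R z))\<^sup>2" by (rule T)
    moreover have "u \<bullet> (S *v z) = z \<bullet> (S *v u)" by (metis sym inner_commute)
    moreover have "2 * t * (z \<bullet> z) = T * (t * (u \<bullet> z * 2)) - t * (2 * (z \<bullet> (S *v u)))"
      unfolding zz by (simp add: inner_commute algebra_simps)
    ultimately show ?thesis
      unfolding q_def power2_norm_eq_inner
      by (simp add: matrix_vector_mult_diff_distrib matrix_vector_mult_scaleR inner_diff_left
          inner_diff_right T_def[symmetric] uu inner_commute algebra_simps)
  qed
  have "z = 0"
  proof (rule ccontr)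
    assume "z \<noteq> 0"
    then have zz: "z \<bullet> z > 0" by simp
    \<comment> \<open>The \<open>+ 1\<close> keeps the denominator positive and yields
      \<open>t * q \<le> z \<bullet> z\<close>, against
      \<open>2 * (z \<bullet> z) \<le> t * q\<close>.\<close>
    define t where "t = (z \<bullet> z) / (q + 1)"
    have t: "t > 0" using zz q by (simp add: t_def)
    with *[of t] have "2 * (z \<bullet> z) \<le> t * q" by simp
    also have "\<dots> \<le> z \<bullet> z" using zz q by (simp add: t_def divide_le_eq)
    finally show False using zz by simp
  qed
  then have "u \<noteq> 0 \<and> S *v u = T *\<^sub>R u" using u by (auto simp: z_def)
  then have "T \<le> largest_eigenvalue S"
    unfolding largest_eigenvalue_def
    by (intro Max_ge finite_eigenvalues_symmetric assms) auto
  then have "T * (norm v)\<^sup>2 \<le> largest_eigenvalue S * (norm v)\<^sup>2"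
    by (rule mult_right_mono) simp
  with T[of v] show ?thesis by linarith
qed

section \<open>Convergence of the primal-dual iteration\<close>

text \<open>Bolzano-Weierstrass for the multipliers, which are functions read only on a finite index
  set and not Euclidean vectors: subsequences are refined one index at a time.\<close>

lemma bounded_family_convergent_subseq:
  fixes a :: "nat \<Rightarrow> 'r \<Rightarrow> real"
  assumes "finite R" "\<And>r. r \<in> R \<Longrightarrow> bounded (range (\<lambda>n. a n r))"
  shows "\<exists>s l. strict_mono s \<and> (\<forall>r\<in>R. (\<lambda>n. a (s n) r) \<longlonglongrightarrow> l r)"
  using assms
proof (induction R)
  case empty
  show ?case by (auto intro: exI[of _ id] simp: strict_mono_def)
next
  case (insert q R)
  then obtain s l where s: "strict_mono (s :: nat \<Rightarrow> nat)" "\<forall>r\<in>R. (\<lambda>n. a (s n) r) \<longlonglongrightarrow> l r"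
    by auto
  have "bounded (range (\<lambda>n. a (s n) q))"
    using insert.prems[of q] by (rule bounded_subset) auto
  then obtain k s' where s': "strict_mono (s' :: nat \<Rightarrow> nat)" "(\<lambda>n. a (s (s' n)) q) \<longlonglongrightarrow> k"
    using bounded_imp_convergent_subsequence[of "\<lambda>n. a (s n) q"] by (auto simp: o_def)
  have "(\<lambda>n. a (s (s' n)) r) \<longlonglongrightarrow> (l(q := k)) r" if "r \<in> insert q R" for r
    using s'(2) LIMSEQ_subseq_LIMSEQ[OF _ s'(1), of "\<lambda>n. a (s n) r" "l r"] s(2) that
    by (auto simp: o_def)
  moreover have "strict_mono (\<lambda>n. s (s' n))"
    using s(1) s'(1) by (simp add: strict_mono_def)
  ultimately show ?case by blast
qed

text \<open>Both parts of the left side are nonnegative, so \<open>u\<close> squeezes each. Applied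
  to the decrease of the Lyapunov function, for the increments, and to the function itself, for the
  distance to the limit.\<close>

lemma tendsto_of_scaled_square_sum:
  fixes d :: "nat \<Rightarrow> real" and e :: "nat \<Rightarrow> 'r \<Rightarrow> real"
  assumes "\<And>n. a * (d n)\<^sup>2 + b * (\<Sum>r\<in>S. (e n r)\<^sup>2) \<le> u n" "u \<longlonglongrightarrow> 0" "a > 0" "b > 0" "finite S"
  shows "d \<longlonglongrightarrow> 0" and "r \<in> S \<Longrightarrow> (\<lambda>n. e n r) \<longlonglongrightarrow> 0"
proof -
  have n: "0 \<le> (\<Sum>r\<in>S. (e n r)\<^sup>2)" for n by (intro sum_nonneg) auto
  have "(\<lambda>n. (d n)\<^sup>2) \<longlonglongrightarrow> 0"
  proof (rule tendsto_sandwich[where f = "\<lambda>_. 0"])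
    show "\<forall>\<^sub>F n in sequentially. (d n)\<^sup>2 \<le> u n / a"
    proof (intro always_eventually allI)
      fix k
      have "0 \<le> b * (\<Sum>r\<in>S. (e k r)\<^sup>2)" using n[of k] assms(4) by simp
      with assms(1)[of k] have "a * (d k)\<^sup>2 \<le> u k" by linarith
      then show "(d k)\<^sup>2 \<le> u k / a" using assms(3) by (simp add: field_simps)
    qed
    show "(\<lambda>n. u n / a) \<longlonglongrightarrow> 0" using assms(2,3) by (auto intro!: tendsto_eq_intros)
  qed auto
  then show "d \<longlonglongrightarrow> 0" by (simp add: power_tendsto_0_iff)
  assume r: "r \<in> S"
  have "(\<lambda>n. (e n r)\<^sup>2) \<longlonglongrightarrow> 0"
  proof (rule tendsto_sandwich[where f = "\<lambda>_. 0"])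
    show "\<forall>\<^sub>F n in sequentially. (e n r)\<^sup>2 \<le> u n / b"
    proof (intro always_eventually allI)
      fix k
      have "(e k r)\<^sup>2 \<le> (\<Sum>r\<in>S. (e k r)\<^sup>2)" using r assms(5) by (intro member_le_sum) auto
      then have "b * (e k r)\<^sup>2 \<le> b * (\<Sum>r\<in>S. (e k r)\<^sup>2)" using assms(4) by simp
      moreover have "0 \<le> a * (d k)\<^sup>2" using assms(3) by simp
      ultimately have "b * (e k r)\<^sup>2 \<le> u k" using assms(1)[of k] by linarith
      then show "(e k r)\<^sup>2 \<le> u k / b" using assms(4) by (simp add: field_simps)
    qed
    show "(\<lambda>n. u n / b) \<longlonglongrightarrow> 0" using assms(2,4) by (auto intro!: tendsto_eq_intros)
  qed auto
  then show "(\<lambda>n. e n r) \<longlonglongrightarrow> 0" by (simp add: power_tendsto_0_iff)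
qed

text \<open>The constraint operator \<open>M\<close> has the rows \<open>m r\<close>, \<open>r \<in> R\<close>; \<open>G\<close> is the gradient of \<open>p\<close>.
  The assumption \<open>step\<close> says \<open>I / c - \<gamma> M\<^sup>T M \<ge> h I\<close>.\<close>

locale primal_dual =
  fixes p :: "'a::euclidean_space \<Rightarrow> real" and G :: "'a \<Rightarrow> 'a" and Q :: "'a \<Rightarrow> ereal"
    and m :: "'r \<Rightarrow> 'a" and R :: "'r set" and c \<gamma> h :: real
  assumes fin: "finite R"
    and subgradient: "\<And>x y. p x + G x \<bullet> (y - x) \<le> p y"
    and cocoercive: "\<And>x y. (norm (G x - G y))\<^sup>2 \<le> h * ((G x - G y) \<bullet> (x - y))"
    and Q: "proper_fun Q" "convex_fun Q" "closed_fun Q"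
    and pos: "h > 0" "c > 0" "\<gamma> > 0"
    and step: "\<And>x. h * (norm x)\<^sup>2 + \<gamma> * (\<Sum>r\<in>R. (m r \<bullet> x)\<^sup>2) \<le> 1 / c * (norm x)\<^sup>2"
begin

definition adj :: "('r \<Rightarrow> real) \<Rightarrow> 'a" where
  "adj \<xi> = (\<Sum>r\<in>R. \<xi> r *\<^sub>R m r)"

text \<open>The system \<open>0 \<in> \<nabla>p + \<partial>Q + M^T x\<close>,
  \<open>M l = 0\<close>, with the inclusion written as a subgradient inequality.\<close>

definition kkt :: "'a \<Rightarrow> ('r \<Rightarrow> real) \<Rightarrow> bool" where
  "kkt l x \<longleftrightarrow> (\<forall>r\<in>R. m r \<bullet> l = 0) \<and> (\<exists>q. Q l = ereal q) \<and>
    (\<forall>y. Q l + ereal (- ((G l + adj x) \<bullet> (y - l))) \<le> Q y)"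

definition lag :: "'a \<Rightarrow> ('r \<Rightarrow> real) \<Rightarrow> ereal" where
  "lag l x = ereal (p l) + Q l + ereal (\<Sum>r\<in>R. x r * (m r \<bullet> l))"

lemma adj_inner: "adj x \<bullet> y = (\<Sum>r\<in>R. x r * (m r \<bullet> y))"
  by (simp add: adj_def inner_sum_left)

lemma Q_not_minf: "Q x \<noteq> -\<infinity>"
  using Q(1) by (simp add: proper_fun_def)

lemma G_lipschitz: "norm (G x - G y) \<le> h * norm (x - y)"
proof (cases "G x = G y")
  case False
  have "(norm (G x - G y))\<^sup>2 \<le> h * ((G x - G y) \<bullet> (x - y))" by (rule cocoercive)
  also have "\<dots> \<le> h * (norm (G x - G y) * norm (x - y))"
    using pos by (intro mult_left_mono norm_cauchy_schwarz) auto
  finally have "norm (G x - G y) * norm (G x - G y) \<le> (h * norm (x - y)) * norm (G x - G y)"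
    by (simp add: power2_eq_square algebra_simps)
  then show ?thesis by (rule mult_right_le_imp_le) (use False in simp)
qed (use pos in simp)

text \<open>The subgradient inequality at \<open>y\<close> combined with the Lipschitz bound. The
  constant \<open>h\<close> in place of the sharper \<open>h / 2\<close> suffices, as the bound
  serves only first-order limits.\<close>

lemma p_upper: "p y \<le> p x + G x \<bullet> (y - x) + h * (norm (y - x))\<^sup>2"
proof -
  have "(G y - G x) \<bullet> (y - x) \<le> norm (G y - G x) * norm (y - x)" by (rule norm_cauchy_schwarz)
  also have "\<dots> \<le> h * norm (y - x) * norm (y - x)"
    by (intro mult_right_mono G_lipschitz) auto
  finally show ?thesis
    using subgradient[of y x]
    by (simp add: inner_diff_left inner_diff_right power2_eq_square)
qed

lemma isCont_G: "isCont G x"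
proof -
  have "((\<lambda>y. norm (G y - G x)) \<longlongrightarrow> 0) (at x)"
  proof (rule tendsto_sandwich[where f = "\<lambda>_. 0"])
    show "((\<lambda>y. h * norm (y - x)) \<longlongrightarrow> 0) (at x)" by (auto intro!: tendsto_eq_intros)
  qed (auto intro!: always_eventually G_lipschitz)
  then show ?thesis
    unfolding isCont_def by (subst Lim_null) (simp add: tendsto_norm_zero_iff)
qed

lemma p_gradient: "gradient (\<lambda>x. ereal (p x)) x = G x"
proof (rule gradient_eqI)
  show "\<bar>p y - p x - G x \<bullet> (y - x)\<bar> \<le> h * (norm (y - x))\<^sup>2" for y
    using p_upper[of y x] subgradient[of x y] by (auto simp: abs_le_iff)
qed simp

section \<open>Saddle points and the optimality system\<close>

lemma kkt_imp_saddle: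
  assumes "kkt l x"
  shows "(l, x) \<in> saddle_points lag"
proof -
  have ml: "\<And>r. r \<in> R \<Longrightarrow> m r \<bullet> l = 0" using assms by (simp add: kkt_def)
  have "lag l x \<le> lag y x" for y
  proof -
    have "Q l + ereal (- ((G l + adj x) \<bullet> (y - l))) \<le> Q y"
      using assms by (simp add: kkt_def)
    moreover have "p l + G l \<bullet> (y - l) \<le> p y" by (rule subgradient)
    moreover have "adj x \<bullet> (y - l) = (\<Sum>r\<in>R. x r * (m r \<bullet> y))"
      unfolding adj_inner by (intro sum.cong) (auto simp: inner_diff_right ml)
    ultimately show ?thesis
      using Q_not_minf[of y] Q_not_minf[of l]
      by (cases "Q l"; cases "Q y") (auto simp: lag_def ml inner_add_left)
  qed
  moreover have "lag l y \<le> lag l x" for y by (simp add: lag_def ml)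
  ultimately show ?thesis by (auto simp: saddle_points_def)
qed

text \<open>Primal optimality is tested on the segment from \<open>l\<close> to \<open>y\<close>:
  convexity of \<open>Q\<close> and the quadratic bound on \<open>p\<close> leave, after division by
  \<open>t\<close>, an error of order \<open>t\<close> that vanishes in the limit.\<close>

lemma saddle_imp_kkt:
  assumes "(l, x) \<in> saddle_points lag"
  shows "kkt l x"
proof -
  have s1: "lag l x \<le> lag y x" and s2: "lag l z \<le> lag l x" for y z
    using assms by (auto simp: saddle_points_def)
  obtain y0 q0 where y0: "Q y0 = ereal q0" using proper_fun_real Q(1) by blast
  obtain q where q: "Q l = ereal q"
    using s1[of y0] Q_not_minf[of l] by (cases "Q l") (auto simp: lag_def y0)
  \<comment> \<open>Moving the multiplier by the residual \<open>M l\<close> itself raises the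
    Lagrangian by the squared norm of \<open>M l\<close>, which therefore is 0.\<close>
  have "(\<Sum>r\<in>R. (m r \<bullet> l)\<^sup>2) \<le> 0"
    using s2[of "\<lambda>r. x r + m r \<bullet> l"]
    by (simp add: lag_def q algebra_simps sum.distrib power2_eq_square)
  then have "(\<Sum>r\<in>R. (m r \<bullet> l)\<^sup>2) = 0" by (intro antisym sum_nonneg) auto
  then have ml: "\<And>r. r \<in> R \<Longrightarrow> m r \<bullet> l = 0"
    using fin by (simp add: sum_nonneg_eq_0_iff)
  have "Q l + ereal (- ((G l + adj x) \<bullet> (y - l))) \<le> Q y" for y
  proof (cases "Q y")
    case (real b)
    define d where "d = y - l"
    define w where "w = (G l + adj x) \<bullet> d"
    have *: "q \<le> b + w + t * h * (norm d)\<^sup>2" if t: "0 < t" "t < 1" for t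
    proof -
      let ?z = "(1 - t) *\<^sub>R l + t *\<^sub>R y"
      have z: "?z = l + t *\<^sub>R d" by (simp add: d_def algebra_simps)
      have "Q ?z \<le> ereal ((1 - t) * q + t * b)"
        using t by (intro convex_funD Q) (auto simp: q real)
      then obtain e where e: "Q ?z = ereal e" "e \<le> (1 - t) * q + t * b"
        using Q_not_minf[of ?z] by (cases "Q ?z") auto
      have "p l + q \<le> p ?z + e + adj x \<bullet> ?z"
        using s1[of ?z] by (simp add: lag_def q e ml adj_inner)
      also have "adj x \<bullet> ?z = t * (adj x \<bullet> d)"
        unfolding z adj_inner by (simp add: inner_add_right ml sum_distrib_left mult.left_commute)
      also have "p ?z \<le> p l + t * (G l \<bullet> d) + h * (t * t * (norm d)\<^sup>2)"
        using p_upper[of ?z l] unfolding z by (simp add: power2_eq_square mult.commute mult.left_commute)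
      finally have "t * q \<le> t * (b + w + t * h * (norm d)\<^sup>2)"
        using e(2) by (simp add: w_def inner_add_left algebra_simps)
      with t show ?thesis by simp
    qed
    have "((\<lambda>t. b + w + t * h * (norm d)\<^sup>2) \<longlongrightarrow> b + w + 0 * h * (norm d)\<^sup>2) (at_right 0)"
      by (intro tendsto_intros)
    moreover have "\<forall>\<^sub>F t in at_right 0. q \<le> b + w + t * h * (norm d)\<^sup>2"
      using * by (auto simp: eventually_at_right_field intro!: exI[of _ 1])
    ultimately have "q \<le> b + w"
      using tendsto_lowerbound[of _ _ "at_right (0::real)" q] by fastforce
    then show ?thesis by (simp add: q real w_def d_def)
  qed (use Q_not_minf[of y] in auto)
  with ml q show ?thesis by (auto simp: kkt_def)
qed

text \<open>The function \<open>V\<close> of the opening text, with the quadratic form of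
  \<open>D = I / c - \<gamma> M^T M\<close> expanded over the rows of \<open>M\<close>.\<close>

definition lyapunov :: "'a \<Rightarrow> ('r \<Rightarrow> real) \<Rightarrow> 'a \<Rightarrow> ('r \<Rightarrow> real) \<Rightarrow> real" where
  "lyapunov ls xs l x = 1 / c * (norm (l - ls))\<^sup>2 - \<gamma> * (\<Sum>r\<in>R. (m r \<bullet> (l - ls))\<^sup>2)
     + 1 / \<gamma> * (\<Sum>r\<in>R. (x r - xs r)\<^sup>2)"

lemma lyapunov_lower:
  "h * (norm (l - ls))\<^sup>2 + 1 / \<gamma> * (\<Sum>r\<in>R. (x r - xs r)\<^sup>2) \<le> lyapunov ls xs l x"
  using step[of "l - ls"] by (simp add: lyapunov_def)

end

section \<open>Descent, boundedness and cluster points of the iterates\<close>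

locale primal_dual_iteration = primal_dual +
  fixes l :: "nat \<Rightarrow> 'a" and x :: "nat \<Rightarrow> 'b \<Rightarrow> real"
  assumes l_Suc: "\<And>t. l (Suc t) = prox c Q (l t - c *\<^sub>R (G (l t) + adj (x t)
      + \<gamma> *\<^sub>R adj (\<lambda>r. m r \<bullet> l t)))"
    and x_Suc: "\<And>t r. r \<in> R \<Longrightarrow> x (Suc t) r = x t r + \<gamma> * (m r \<bullet> l (Suc t))"
begin

text \<open>The subgradient of \<open>Q\<close> at \<open>l (Suc t)\<close> that the proximal step
  supplies: prox argument minus new iterate, divided by \<open>c\<close>.\<close>

definition iterate_slope :: "nat \<Rightarrow> 'a" where
  "iterate_slope t = (1 / c) *\<^sub>R (l t - l (Suc t)) - G (l t) - adj (x t) - \<gamma> *\<^sub>R adj (\<lambda>r. m r \<bullet> l t)"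

lemma iterate_subgradient: "Q (l (Suc t)) + ereal (iterate_slope t \<bullet> (y - l (Suc t))) \<le> Q y"
proof -
  let ?v = "l t - c *\<^sub>R (G (l t) + adj (x t) + \<gamma> *\<^sub>R adj (\<lambda>r. m r \<bullet> l t))"
  have "iterate_slope t = (1 / c) *\<^sub>R (?v - l (Suc t))"
    using pos by (simp add: iterate_slope_def scaleR_diff_right scaleR_add_right)
  then have "iterate_slope t \<bullet> (y - l (Suc t)) = 1 / c * ((?v - l (Suc t)) \<bullet> (y - l (Suc t)))"
    by simp
  then show ?thesis
    using prox_inequality[OF Q pos(2), of ?v y] by (simp only: l_Suc)
qed

text \<open>By \<open>step\<close>, the \<open>D\<close>-norm of the increment contributes at least
  \<open>h\<close> times its squared norm; the gradient error costs half of that.\<close>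

lemma lyapunov_decrease:
  assumes "kkt ls xs"
  shows "lyapunov ls xs (l (Suc t)) (x (Suc t)) + h / 2 * (norm (l (Suc t) - l t))\<^sup>2
      + 1 / \<gamma> * (\<Sum>r\<in>R. (x (Suc t) r - x t r)\<^sup>2) \<le> lyapunov ls xs (l t) (x t)"
proof -
  define L L' X X' where "L = l t" and "L' = l (Suc t)" and "X = x t" and "X' = x (Suc t)"
  have ml: "\<And>r. r \<in> R \<Longrightarrow> m r \<bullet> ls = 0" using assms by (simp add: kkt_def)
  have X': "X' r = X r + \<gamma> * (m r \<bullet> L')" if "r \<in> R" for r
    using x_Suc[OF that] by (simp add: X'_def X_def L'_def)
  have wt: "iterate_slope t = (1 / c) *\<^sub>R (L - L') - G L - adj X - \<gamma> *\<^sub>R adj (\<lambda>r. m r \<bullet> L)"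
    by (simp add: iterate_slope_def L_def L'_def X_def)
  have "Q L' + ereal (iterate_slope t \<bullet> (ls - L')) \<le> Q ls"
    unfolding L'_def by (rule iterate_subgradient)
  moreover have "Q ls + ereal (- ((G ls + adj xs) \<bullet> (L' - ls))) \<le> Q L'"
    using assms by (simp add: kkt_def)
  moreover obtain q where "Q ls = ereal q" using assms by (auto simp: kkt_def)
  \<comment> \<open>Monotonicity of the subdifferential of \<open>Q\<close> between the new iterate
    and \<open>ls\<close>.\<close>
  ultimately have "0 \<le> (iterate_slope t + G ls + adj xs) \<bullet> (L' - ls)"
    using Q_not_minf[of L']
    by (cases "Q L'") (auto simp: inner_diff_right inner_add_left)
  also have "\<dots> = 1 / c * ((L - L') \<bullet> (L' - ls)) + (G ls - G L) \<bullet> (L' - ls)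
      + (adj xs \<bullet> (L' - ls) - adj X \<bullet> (L' - ls) - \<gamma> * (adj (\<lambda>r. m r \<bullet> L) \<bullet> (L' - ls)))"
    unfolding wt by (simp add: inner_diff_left inner_add_left)
  \<comment> \<open>Row by row: since \<open>m r \<bullet> ls = 0\<close>, only
    \<open>m r \<bullet> L\<close> and \<open>m r \<bullet> L'\<close> occur, and the multiplier
    update \<open>X' r - X r = \<gamma> * (m r \<bullet> L')\<close> completes the squares.\<close>
  also have "adj xs \<bullet> (L' - ls) - adj X \<bullet> (L' - ls) - \<gamma> * (adj (\<lambda>r. m r \<bullet> L) \<bullet> (L' - ls))
      = (\<Sum>r\<in>R. \<gamma> / 2 * ((m r \<bullet> (L' - ls))\<^sup>2 - (m r \<bullet> (L - ls))\<^sup>2 + (m r \<bullet> (L' - L))\<^sup>2)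
        + 1 / (2 * \<gamma>) * ((X r - xs r)\<^sup>2 - (X' r - xs r)\<^sup>2 - (X' r - X r)\<^sup>2))"
    unfolding adj_inner sum_distrib_left sum_subtractf[symmetric]
  proof (rule sum.cong[OF refl])
    fix r assume r: "r \<in> R"
    define a a' where "a = m r \<bullet> L" and "a' = m r \<bullet> L'"
    have "xs r * a' - X r * a' - \<gamma> * (a * a') = \<gamma> / 2 * (a'\<^sup>2 - a\<^sup>2 + (a' - a)\<^sup>2)
        + 1 / (2 * \<gamma>) * ((X r - xs r)\<^sup>2 - (X r + \<gamma> * a' - xs r)\<^sup>2 - (\<gamma> * a')\<^sup>2)"
      using pos by (simp add: field_simps power2_eq_square)
    then show "xs r * (m r \<bullet> (L' - ls)) - X r * (m r \<bullet> (L' - ls)) - \<gamma> * (m r \<bullet> L * (m r \<bullet> (L' - ls)))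
      = \<gamma> / 2 * ((m r \<bullet> (L' - ls))\<^sup>2 - (m r \<bullet> (L - ls))\<^sup>2 + (m r \<bullet> (L' - L))\<^sup>2)
        + 1 / (2 * \<gamma>) * ((X r - xs r)\<^sup>2 - (X' r - xs r)\<^sup>2 - (X' r - X r)\<^sup>2)"
      using ml[OF r] X'[OF r] by (simp add: inner_diff_right a_def a'_def)
  qed
  also have "\<dots> = \<gamma> / 2 * ((\<Sum>r\<in>R. (m r \<bullet> (L' - ls))\<^sup>2) - (\<Sum>r\<in>R. (m r \<bullet> (L - ls))\<^sup>2)
        + (\<Sum>r\<in>R. (m r \<bullet> (L' - L))\<^sup>2))
      + 1 / (2 * \<gamma>) * ((\<Sum>r\<in>R. (X r - xs r)\<^sup>2) - (\<Sum>r\<in>R. (X' r - xs r)\<^sup>2)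
        - (\<Sum>r\<in>R. (X' r - X r)\<^sup>2))"
    by (simp only: sum.distrib sum_subtractf sum_distrib_left[symmetric])
  also have "(L - L') \<bullet> (L' - ls) = ((norm (L - ls))\<^sup>2 - (norm (L' - ls))\<^sup>2 - (norm (L' - L))\<^sup>2) / 2"
    unfolding power2_norm_eq_inner
    by (simp add: inner_diff_left inner_diff_right inner_commute)
  finally have main: "0 \<le> 1 / c * (((norm (L - ls))\<^sup>2 - (norm (L' - ls))\<^sup>2 - (norm (L' - L))\<^sup>2) / 2)
      + (G ls - G L) \<bullet> (L' - ls)
      + (\<gamma> / 2 * ((\<Sum>r\<in>R. (m r \<bullet> (L' - ls))\<^sup>2) - (\<Sum>r\<in>R. (m r \<bullet> (L - ls))\<^sup>2)
        + (\<Sum>r\<in>R. (m r \<bullet> (L' - L))\<^sup>2))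
      + 1 / (2 * \<gamma>) * ((\<Sum>r\<in>R. (X r - xs r)\<^sup>2) - (\<Sum>r\<in>R. (X' r - xs r)\<^sup>2)
        - (\<Sum>r\<in>R. (X' r - X r)\<^sup>2)))" .
  have "(G ls - G L) \<bullet> (L' - ls) \<le> h / 4 * (norm (L' - L))\<^sup>2"
  proof -
    define d where "d = G ls - G L"
    have "(norm d)\<^sup>2 \<le> h * (d \<bullet> (ls - L))" unfolding d_def by (rule cocoercive)
    \<comment> \<open>Young's inequality with weight \<open>h / 2\<close>; its squared norm of
      \<open>d\<close> cancels against the one from cocoercivity.\<close>
    moreover have "0 \<le> (norm (d - (h / 2) *\<^sub>R (L' - L)))\<^sup>2" by simp
    then have "h * (d \<bullet> (L' - L)) \<le> (norm d)\<^sup>2 + h * (h / 4 * (norm (L' - L))\<^sup>2)"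
      unfolding power2_norm_eq_inner
      by (simp add: inner_diff_left inner_diff_right inner_commute algebra_simps)
    ultimately have "h * (d \<bullet> (L' - ls)) \<le> h * (h / 4 * (norm (L' - L))\<^sup>2)"
      by (simp add: inner_diff_right algebra_simps)
    then show ?thesis using pos by (simp add: d_def)
  qed
  with main step[of "L' - L"]
  show ?thesis
    unfolding lyapunov_def L_def[symmetric] L'_def[symmetric] X_def[symmetric] X'_def[symmetric]
    by (simp add: add_divide_distrib diff_divide_distrib algebra_simps)
qed

lemma lyapunov_antimono:
  assumes "kkt ls xs"
  shows "decseq (\<lambda>t. lyapunov ls xs (l t) (x t))"
proof (rule decseq_SucI)
  fix t
  have "0 \<le> h / 2 * (norm (l (Suc t) - l t))\<^sup>2" "0 \<le> 1 / \<gamma> * (\<Sum>r\<in>R. (x (Suc t) r - x t r)\<^sup>2)"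
    using pos by (auto intro!: mult_nonneg_nonneg sum_nonneg divide_nonneg_nonneg)
  with lyapunov_decrease[OF assms, of t]
  show "lyapunov ls xs (l (Suc t)) (x (Suc t)) \<le> lyapunov ls xs (l t) (x t)" by linarith
qed

text \<open>Nonincreasing, nonnegative Lyapunov values converge, so their successive differences,
  which dominate the squared increments, tend to 0.\<close>

lemma increments_tendsto_0:
  assumes "kkt ls xs"
  shows "(\<lambda>t. l (Suc t) - l t) \<longlonglongrightarrow> 0" and "r \<in> R \<Longrightarrow> (\<lambda>t. x (Suc t) r - x t r) \<longlonglongrightarrow> 0"
proof -
  let ?V = "\<lambda>t. lyapunov ls xs (l t) (x t)"
  have "0 \<le> h * (norm (l t - ls))\<^sup>2 + 1 / \<gamma> * (\<Sum>r\<in>R. (x t r - xs r)\<^sup>2)" for t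
    using pos by (auto intro!: add_nonneg_nonneg mult_nonneg_nonneg sum_nonneg divide_nonneg_nonneg)
  then have "0 \<le> ?V t" for t
    using lyapunov_lower[of "l t" ls "x t" xs] order_trans by blast
  then obtain v where v: "?V \<longlonglongrightarrow> v"
    using decseq_convergent[OF lyapunov_antimono[OF assms], of 0] by metis
  have u: "(\<lambda>t. ?V t - ?V (Suc t)) \<longlonglongrightarrow> 0"
    using tendsto_diff[OF v LIMSEQ_Suc[OF v]] by simp
  have le: "h / 2 * (norm (l (Suc t) - l t))\<^sup>2 + 1 / \<gamma> * (\<Sum>r\<in>R. (x (Suc t) r - x t r)\<^sup>2)
      \<le> ?V t - ?V (Suc t)" for t
    using lyapunov_decrease[OF assms, of t] by linarith
  have p: "h / 2 > 0" "1 / \<gamma> > 0" using pos by auto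
  show "(\<lambda>t. l (Suc t) - l t) \<longlonglongrightarrow> 0"
    using tendsto_of_scaled_square_sum(1)[OF le u p fin] by (rule tendsto_norm_zero_cancel)
  show "r \<in> R \<Longrightarrow> (\<lambda>t. x (Suc t) r - x t r) \<longlonglongrightarrow> 0"
    using tendsto_of_scaled_square_sum(2)[OF le u p fin] .
qed

lemma iterates_bounded:
  assumes "kkt ls xs"
  shows "bounded (range l)" and "r \<in> R \<Longrightarrow> bounded (range (\<lambda>t. x t r))"
proof -
  define V where "V = lyapunov ls xs (l 0) (x 0)"
  have V: "h * (norm (l t - ls))\<^sup>2 + 1 / \<gamma> * (\<Sum>r\<in>R. (x t r - xs r)\<^sup>2) \<le> V" for t
    using lyapunov_lower[of "l t" ls "x t" xs] decseqD[OF lyapunov_antimono[OF assms], of 0 t]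
    unfolding V_def by simp
  have "(norm (l t - ls))\<^sup>2 \<le> V / h" for t
  proof -
    have "0 \<le> 1 / \<gamma> * (\<Sum>r\<in>R. (x t r - xs r)\<^sup>2)"
      using pos by (auto intro!: mult_nonneg_nonneg sum_nonneg divide_nonneg_nonneg)
    with V[of t] have "h * (norm (l t - ls))\<^sup>2 \<le> V" by linarith
    with pos show ?thesis by (simp add: field_simps)
  qed
  then have "l t \<in> cball ls (sqrt (V / h))" for t
    by (simp add: dist_norm norm_minus_commute real_le_rsqrt)
  then show "bounded (range l)"
    by (intro bounded_subset[OF bounded_cball]) auto
  assume r: "r \<in> R"
  have "(x t r - xs r)\<^sup>2 \<le> V * \<gamma>" for t
  proof -
    have "(x t r - xs r)\<^sup>2 \<le> (\<Sum>r\<in>R. (x t r - xs r)\<^sup>2)"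
      using r fin by (intro member_le_sum) auto
    then have "1 / \<gamma> * (x t r - xs r)\<^sup>2 \<le> 1 / \<gamma> * (\<Sum>r\<in>R. (x t r - xs r)\<^sup>2)"
      using pos by (intro mult_left_mono) auto
    moreover have "0 \<le> h * (norm (l t - ls))\<^sup>2" using pos by simp
    ultimately have "1 / \<gamma> * (x t r - xs r)\<^sup>2 \<le> V" using V[of t] by linarith
    with pos show ?thesis by (simp add: field_simps)
  qed
  then have "x t r \<in> cball (xs r) (sqrt (V * \<gamma>))" for t
    by (simp add: dist_norm real_le_rsqrt power2_commute)
  then show "bounded (range (\<lambda>t. x t r))"
    by (intro bounded_subset[OF bounded_cball]) auto
qed

lemma tendsto_adj: "(\<And>r. r \<in> R \<Longrightarrow> (\<lambda>n. y n r) \<longlonglongrightarrow> z r) \<Longrightarrow> (\<lambda>n. adj (y n)) \<longlonglongrightarrow> adj z"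
  unfolding adj_def by (intro tendsto_sum tendsto_scaleR) auto

text \<open>Vanishing increments give the shifted subsequence the same limit, so the subgradient
  inequality of the proximal step passes to the limit; closedness of \<open>epi Q\<close> stands in
  for continuity of \<open>Q\<close>.\<close>

lemma cluster_point_kkt:
  assumes "kkt ls xs" and s: "strict_mono (s :: nat \<Rightarrow> nat)"
    and lim: "(\<lambda>n. l (s n)) \<longlonglongrightarrow> lh" "\<And>r. r \<in> R \<Longrightarrow> (\<lambda>n. x (s n) r) \<longlonglongrightarrow> xh r"
  shows "kkt lh xh"
proof -
  have dl: "(\<lambda>n. l (Suc (s n)) - l (s n)) \<longlonglongrightarrow> 0"
    using LIMSEQ_subseq_LIMSEQ[OF increments_tendsto_0(1)[OF assms(1)] s] by (simp add: o_def)
  have dx: "(\<lambda>n. x (Suc (s n)) r - x (s n) r) \<longlonglongrightarrow> 0" if "r \<in> R" for r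
    using LIMSEQ_subseq_LIMSEQ[OF increments_tendsto_0(2)[OF assms(1) that] s] by (simp add: o_def)
  have l': "(\<lambda>n. l (Suc (s n))) \<longlonglongrightarrow> lh"
    using tendsto_add[OF lim(1) dl] by simp
  have ml: "m r \<bullet> lh = 0" if "r \<in> R" for r
  proof -
    \<comment> \<open>The residual at the new iterate is the multiplier increment divided by
      \<open>\<gamma>\<close>.\<close>
    have "(\<lambda>n. (x (Suc (s n)) r - x (s n) r) / \<gamma>) \<longlonglongrightarrow> 0 / \<gamma>"
      using pos by (intro tendsto_divide dx that) auto
    then have "(\<lambda>n. m r \<bullet> l (Suc (s n))) \<longlonglongrightarrow> 0"
      using pos x_Suc[OF that] by simp
    moreover have "(\<lambda>n. m r \<bullet> l (Suc (s n))) \<longlonglongrightarrow> m r \<bullet> lh"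
      by (intro tendsto_intros l')
    ultimately show ?thesis using LIMSEQ_unique by blast
  qed
  have G: "(\<lambda>n. G (l (s n))) \<longlonglongrightarrow> G lh"
    by (rule isCont_tendsto_compose[OF isCont_G lim(1)])
  have mls: "(\<lambda>n. m r \<bullet> l (s n)) \<longlonglongrightarrow> 0" if "r \<in> R" for r
    using tendsto_inner[OF tendsto_const lim(1), of "m r"] ml[OF that] by simp
  have lim_w: "(\<lambda>n. iterate_slope (s n)) \<longlonglongrightarrow> (1 / c) *\<^sub>R (lh - lh) - G lh - adj xh - \<gamma> *\<^sub>R adj (\<lambda>r. 0)"
    unfolding iterate_slope_def by (intro tendsto_intros lim(1) l' G tendsto_adj lim(2) mls)
  define v where "v = G lh + adj xh"
  from lim_w have w: "(\<lambda>n. iterate_slope (s n)) \<longlonglongrightarrow> - v"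
    by (simp add: adj_def v_def)
  have key: "Q lh \<le> ereal (b - (- v) \<bullet> (y - lh))" if "Q y = ereal b" for y b
  proof (rule closed_fun_seq_limit[OF Q(3) l'])
    show "(\<lambda>n. b - iterate_slope (s n) \<bullet> (y - l (Suc (s n)))) \<longlonglongrightarrow> b - (- v) \<bullet> (y - lh)"
      by (intro tendsto_intros w l')
    show "Q (l (Suc (s n))) \<le> ereal (b - iterate_slope (s n) \<bullet> (y - l (Suc (s n))))" for n
      using iterate_subgradient[of "s n" y] Q_not_minf[of "l (Suc (s n))"]
      by (cases "Q (l (Suc (s n)))") (auto simp: that)
  qed
  obtain y0 q0 where "Q y0 = ereal q0" using proper_fun_real Q(1) by blast
  from key[OF this] obtain q where q: "Q lh = ereal q"
    using Q_not_minf[of lh] by (cases "Q lh") auto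
  have "Q lh + ereal (- ((G lh + adj xh) \<bullet> (y - lh))) \<le> Q y" for y
    using key[of y] Q_not_minf[of y] by (cases "Q y") (auto simp: q v_def[symmetric])
  with ml q show ?thesis by (auto simp: kkt_def)
qed

text \<open>A Fejer argument: recentred at a cluster point, which is again a solution, the Lyapunov
  function is monotone and tends to 0 along a subsequence. Hence all of it tends to 0, and it
  dominates the distance to that point.\<close>

lemma iterates_converge:
  assumes "kkt ls xs"
  shows "\<exists>lh xh. kkt lh xh \<and> l \<longlonglongrightarrow> lh \<and> (\<forall>r\<in>R. (\<lambda>t. x t r) \<longlonglongrightarrow> xh r)"
proof -
  obtain s1 lh where s1: "strict_mono (s1 :: nat \<Rightarrow> nat)" "(\<lambda>n. l (s1 n)) \<longlonglongrightarrow> lh"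
    using bounded_imp_convergent_subsequence[OF iterates_bounded(1)[OF assms]] by (auto simp: o_def)
  have "bounded (range (\<lambda>n. x (s1 n) r))" if "r \<in> R" for r
    using iterates_bounded(2)[OF assms that] by (rule bounded_subset) auto
  then obtain s2 xh where s2: "strict_mono (s2 :: nat \<Rightarrow> nat)"
      "\<And>r. r \<in> R \<Longrightarrow> (\<lambda>n. x (s1 (s2 n)) r) \<longlonglongrightarrow> xh r"
    using bounded_family_convergent_subseq[OF fin, of "\<lambda>n. x (s1 n)"] by blast
  define s where "s n = s1 (s2 n)" for n
  have s: "strict_mono s" using s1(1) s2(1) by (simp add: s_def strict_mono_def)
  have ls: "(\<lambda>n. l (s n)) \<longlonglongrightarrow> lh"
    using LIMSEQ_subseq_LIMSEQ[OF s1(2) s2(1)] by (simp add: s_def o_def)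
  have xs: "(\<lambda>n. x (s n) r) \<longlonglongrightarrow> xh r" if "r \<in> R" for r
    using s2(2)[OF that] by (simp add: s_def)
  have kkt: "kkt lh xh" by (rule cluster_point_kkt[OF assms s ls xs])
  let ?V = "\<lambda>t. lyapunov lh xh (l t) (x t)"
  have "(\<lambda>n. ?V (s n)) \<longlonglongrightarrow> 1 / c * (norm (lh - lh))\<^sup>2 - \<gamma> * (\<Sum>r\<in>R. (m r \<bullet> (lh - lh))\<^sup>2)
     + 1 / \<gamma> * (\<Sum>r\<in>R. (xh r - xh r)\<^sup>2)"
    unfolding lyapunov_def by (intro tendsto_intros ls xs)
  then have Vs: "(\<lambda>n. ?V (s n)) \<longlonglongrightarrow> 0" by simp
  have Vnn: "0 \<le> ?V t" for t
  proof -
    have "0 \<le> h * (norm (l t - lh))\<^sup>2 + 1 / \<gamma> * (\<Sum>r\<in>R. (x t r - xh r)\<^sup>2)"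
      using pos by (auto intro!: add_nonneg_nonneg mult_nonneg_nonneg sum_nonneg divide_nonneg_nonneg)
    with lyapunov_lower[of "l t" lh "x t" xh] show ?thesis by linarith
  qed
  then obtain v where v: "?V \<longlonglongrightarrow> v"
    using decseq_convergent[OF lyapunov_antimono[OF kkt], of 0] by metis
  have "v = 0"
    using LIMSEQ_subseq_LIMSEQ[OF v s] Vs LIMSEQ_unique by (auto simp: o_def)
  with v have V0: "?V \<longlonglongrightarrow> 0" by simp
  have p: "h > 0" "1 / \<gamma> > 0" using pos by auto
  note lim = tendsto_of_scaled_square_sum[OF lyapunov_lower V0 p fin]
  have "l \<longlonglongrightarrow> lh"
    using tendsto_norm_zero_cancel[OF lim(1)] by (simp add: LIM_zero_iff)
  moreover have "(\<lambda>t. x t r) \<longlonglongrightarrow> xh r" if "r \<in> R" for r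
    using lim(2)[OF that] by (simp add: LIM_zero_iff)
  ultimately show ?thesis using kkt by blast
qed

end

section \<open>The dual problem\<close>

definition stack :: "('n::finite \<Rightarrow> real^'c::finite) \<Rightarrow> real^('n \<times> 'c)" where
  "stack u = (\<chi> p. u (fst p) $ snd p)"

lemma block_stack [simp]: "block i (stack u) = u i"
  by (simp add: block_def stack_def vec_eq_iff)

lemma block_diff: "block i (x - y) = block i x - block i y"
  by (simp add: block_def vec_eq_iff)

lemma linear_block: "linear (block i)"
  by (rule linearI) (simp_all add: block_def vec_eq_iff)

lemma inner_block: "x \<bullet> y = (\<Sum>i\<in>UNIV. block i x \<bullet> block i y)"
  by (simp add: inner_vec_def block_def sum.cartesian_product UNIV_Times_UNIV[symmetric]
      del: UNIV_Times_UNIV)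

lemma hcat_mult_vec: "hcat S T *v z = S *v (\<chi> a. z $ Inl a) + T *v (\<chi> c. z $ Inr c)"
  by (simp add: vec_eq_iff matrix_vector_mult_def hcat_def UNIV_Plus_UNIV[symmetric] sum.Plus
      del: UNIV_Plus_UNIV)

lemma inner_transpose_mult: "(transpose S *v u) \<bullet> z = u \<bullet> (S *v z)"
  for S :: "real^'c::finite^'r::finite"
  by (simp add: dot_lmul_matrix)

lemma norm_mult_spectral_norm: "norm (S *v z) \<le> spectral_norm S * norm z"
  unfolding spectral_norm_def by (rule onorm[OF matrix_vector_mul_bounded_linear])

lemma spectral_norm_nonneg: "0 \<le> spectral_norm S"
  unfolding spectral_norm_def by (rule onorm_pos_le[OF matrix_vector_mul_bounded_linear])

text \<open>Pairing the transposed image with itself and moving \<open>S\<close> across produces one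
  factor of its norm on each side, which cancels.\<close>

lemma norm_transpose_mult_spectral_norm:
  fixes S :: "real^'c::finite^'r::finite"
  shows "norm (transpose S *v u) \<le> spectral_norm S * norm u"
proof (cases "transpose S *v u = 0")
  case False
  let ?z = "transpose S *v u"
  have "norm ?z * norm ?z = u \<bullet> (S *v ?z)"
    by (simp only: inner_transpose_mult[symmetric] power2_norm_eq_inner[symmetric] power2_eq_square)
  also have "\<dots> \<le> norm u * norm (S *v ?z)" by (rule norm_cauchy_schwarz)
  also have "\<dots> \<le> norm u * (spectral_norm S * norm ?z)"
    by (intro mult_left_mono norm_mult_spectral_norm) simp
  finally have "norm ?z * norm ?z \<le> (spectral_norm S * norm u) * norm ?z"
    by (simp add: algebra_simps)
  then show ?thesis by (rule mult_right_le_imp_le) (use False in simp)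
qed (simp add: spectral_norm_nonneg)

text \<open>The block \<open>- mat 1\<close> sends a unit vector to a unit vector, so the norm is at
  least 1. This makes \<open>h\<close> positive.\<close>

lemma spectral_norm_H_mat_pos:
  fixes A :: "real^('n::finite \<times> 'm::finite)^'b::finite"
  shows "spectral_norm (H_mat A i) > 0"
proof -
  obtain j :: 'm where True by blast
  let ?z = "axis (Inr j) 1 :: real^('b + 'm)"
  have "H_mat A i *v ?z = - axis j 1"
    unfolding H_mat_def matrix_vector_mult_basis
    by (simp add: hcat_def column_def vec_eq_iff axis_def mat_def)
  then have "1 \<le> spectral_norm (H_mat A i) * norm ?z"
    using norm_mult_spectral_norm[of "H_mat A i" ?z] by simp
  then show ?thesis by simp
qed

section \<open>The constant \<open>h\<close> and the gradient of \<open>P\<close>\<close>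

lemma h_const_ge: "(spectral_norm (H_mat A i))\<^sup>2 / \<sigma> i \<le> h_const A \<sigma>"
  unfolding h_const_def by (rule Max_ge) auto

lemma h_const_pos:
  fixes A :: "real^('n::finite \<times> 'm::finite)^'b::finite"
  assumes "\<And>i. \<sigma> i > 0"
  shows "h_const A \<sigma> > 0"
proof -
  obtain i :: 'n where True by blast
  have "0 < (spectral_norm (H_mat A i))\<^sup>2 / \<sigma> i"
    using spectral_norm_H_mat_pos[of A i] assms[of i] by simp
  also note h_const_ge
  finally show ?thesis .
qed

text \<open>By the chain rule, block \<open>i\<close> of the gradient is
  \<open>H_i^T U_i(H_i \<lambda>_i)\<close> plus a constant vector that cancels in differences. The
  transpose costs the squared norm of \<open>H_i\<close> and strong monotonicity in
  \<open>U_i\<close> contributes \<open>1 / \<sigma> i\<close>, which together form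
  \<open>h_i\<close>.\<close>

lemma P_fun_cocoercive_gradient:
  fixes A :: "real^('n::finite \<times> 'm::finite)^'b::finite"
  assumes "\<And>i. proper_fun (f i)" "\<And>i. closed_fun (f i)" "\<And>i. \<sigma> i > 0"
    "\<And>i. strongly_convex_fun (\<sigma> i) (f i)"
  obtains p G where "\<And>x. P_fun f A b \<kappa> x = ereal (p x)"
    "\<And>x y. p x + G x \<bullet> (y - x) \<le> p y"
    "\<And>x y. (norm (G x - G y))\<^sup>2 \<le> h_const A \<sigma> * ((G x - G y) \<bullet> (x - y))"
proof -
  have "\<forall>i. \<exists>\<phi> U. (\<forall>v. fenchel (f i) v = ereal (\<phi> v)) \<and>
    (\<forall>v w. \<phi> v + U v \<bullet> (w - v) \<le> \<phi> w) \<and>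
    (\<forall>v w. \<sigma> i * (norm (U v - U w))\<^sup>2 \<le> (U v - U w) \<bullet> (v - w))"
    by (metis fenchel_strongly_convex assms)
  then obtain \<phi> U where
      \<phi>: "\<And>i v. fenchel (f i) v = ereal (\<phi> i v)" and
      sub: "\<And>i v w. \<phi> i v + U i v \<bullet> (w - v) \<le> \<phi> i w" and
      mono: "\<And>i v w. \<sigma> i * (norm (U i v - U i w))\<^sup>2 \<le> (U i v - U i w) \<bullet> (v - w)"
    by metis
  define H where "H = H_mat A"
  define e where "e = (E_mat b :: real^('b + 'm)^1) $ 1"
  have e: "(E_mat b *v z) $ 1 = e \<bullet> z" for z :: "real^('b + 'm)"
    by (simp add: e_def matrix_vector_mul_component)
  define p where "p x = (\<Sum>i\<in>UNIV. \<phi> i (H i *v block i x) + \<kappa> i * (e \<bullet> block i x))" for x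
  define u where "u i x = U i (H i *v block i x)" for i x
  define G where "G x = stack (\<lambda>i. transpose (H i) *v u i x + \<kappa> i *\<^sub>R e)" for x
  have block_G: "block i (G x) = transpose (H i) *v u i x + \<kappa> i *\<^sub>R e" for i x
    by (simp add: G_def)
  show ?thesis
  proof (rule that[of p G])
    show "P_fun f A b \<kappa> x = ereal (p x)" for x
      by (simp add: P_fun_def \<phi> p_def e H_def)
    show "p x + G x \<bullet> (y - x) \<le> p y" for x y
    proof -
      have "p x + G x \<bullet> (y - x) = (\<Sum>i\<in>UNIV. \<phi> i (H i *v block i x)
          + u i x \<bullet> (H i *v block i y - H i *v block i x) + \<kappa> i * (e \<bullet> block i y))"
        unfolding p_def inner_block[of "G x"] sum.distrib[symmetric] block_G
          inner_add_left inner_transpose_mult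
        by (intro sum.cong refl)
           (simp add: block_diff matrix_vector_mult_diff_distrib inner_diff_right algebra_simps)
      also have "\<dots> \<le> p y"
        unfolding p_def u_def by (intro sum_mono add_right_mono sub)
      finally show ?thesis .
    qed
    fix x y
    define d where "d i = u i x - u i y" for i
    have Gd: "block i (G x - G y) = transpose (H i) *v d i" for i
      by (simp add: block_G block_diff d_def matrix_vector_mult_diff_distrib)
    have "(norm (G x - G y))\<^sup>2 = (\<Sum>i\<in>UNIV. (norm (transpose (H i) *v d i))\<^sup>2)"
      by (simp only: power2_norm_eq_inner inner_block[of "G x - G y"] Gd)
    also have "\<dots> \<le> (\<Sum>i\<in>UNIV. h_const A \<sigma> * ((transpose (H i) *v d i) \<bullet> block i (x - y)))"
    proof (rule sum_mono)
      fix i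
      have "(norm (transpose (H i) *v d i))\<^sup>2 \<le> (spectral_norm (H i) * norm (d i))\<^sup>2"
        by (intro power_mono norm_transpose_mult_spectral_norm) simp
      also have "\<dots> = (spectral_norm (H i))\<^sup>2 / \<sigma> i * (\<sigma> i * (norm (d i))\<^sup>2)"
        using assms(3)[of i] by (simp add: power_mult_distrib)
      also have "\<dots> \<le> h_const A \<sigma> * (d i \<bullet> (H i *v block i x - H i *v block i y))"
        unfolding H_def d_def u_def
        using h_const_pos[of \<sigma> A, OF assms(3)]
        by (intro mult_mono h_const_ge mono) (simp_all add: less_imp_le[OF assms(3)] less_imp_le)
      also have "d i \<bullet> (H i *v block i x - H i *v block i y) = (transpose (H i) *v d i) \<bullet> block i (x - y)"
        unfolding inner_transpose_mult by (simp add: block_diff matrix_vector_mult_diff_distrib)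
      finally show "(norm (transpose (H i) *v d i))\<^sup>2
          \<le> h_const A \<sigma> * ((transpose (H i) *v d i) \<bullet> block i (x - y))" .
    qed
    also have "\<dots> = h_const A \<sigma> * ((G x - G y) \<bullet> (x - y))"
      by (simp only: inner_block[of "G x - G y"] Gd sum_distrib_left)
    finally show "(norm (G x - G y))\<^sup>2 \<le> h_const A \<sigma> * ((G x - G y) \<bullet> (x - y))" .
  qed
qed

section \<open>Regularity of \<open>Q\<close>\<close>

lemma add_indicator_fun_regular:
  fixes g :: "'a::euclidean_space \<Rightarrow> ereal"
  assumes "proper_fun g" "convex_fun g" "closed_fun g" "convex S" "closed S"
  shows "convex_fun (\<lambda>x. g x + indicator_fun S x)" "closed_fun (\<lambda>x. g x + indicator_fun S x)"
proof -
  have "epi (indicator_fun S) = S \<times> {0..}"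
    by (auto simp: epi_def indicator_fun_def zero_ereal_def split: if_splits)
  then have "convex_fun (indicator_fun S)" "closed_fun (indicator_fun S)"
    using assms(4,5) by (auto simp: convex_fun_def closed_fun_def convex_Times closed_Times)
  moreover have "indicator_fun S x \<noteq> -\<infinity>" for x
    by (simp add: indicator_fun_def)
  ultimately show "convex_fun (\<lambda>x. g x + indicator_fun S x)" "closed_fun (\<lambda>x. g x + indicator_fun S x)"
    using assms by (auto intro!: convex_fun_add closed_fun_add simp: proper_fun_def)
qed

lemma Q_fun_regular:
  fixes g :: "'n::finite \<Rightarrow> real^'m::finite \<Rightarrow> ereal"
  assumes "\<And>i. proper_fun (\<lambda>x. g i x + indicator_fun (X i) x)"
    "\<And>i. convex_fun (\<lambda>x. g i x + indicator_fun (X i) x)"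
    "\<And>i. closed_fun (\<lambda>x. g i x + indicator_fun (X i) x)"
  shows "proper_fun (Q_fun g X :: real^('n \<times> ('b::finite + 'm)) \<Rightarrow> ereal)"
    "convex_fun (Q_fun g X :: real^('n \<times> ('b::finite + 'm)) \<Rightarrow> ereal)"
    "closed_fun (Q_fun g X :: real^('n \<times> ('b::finite + 'm)) \<Rightarrow> ereal)"
proof -
  define q where "q i = fenchel (\<lambda>x. g i x + indicator_fun (X i) x)" for i
  define k :: "'n \<Rightarrow> real^('n \<times> ('b + 'm)) \<Rightarrow> real^'m" where "k i x = F_mat *v block i x" for i x
  have Q: "Q_fun g X = (\<lambda>x. \<Sum>i\<in>UNIV. q i (k i x))"
    by (simp add: Q_fun_def q_def k_def fun_eq_iff)
  have proper: "proper_fun (q i)" for i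
    unfolding q_def by (intro proper_fun_fenchel assms)
  then have nm: "q i v \<noteq> -\<infinity>" for i v by (simp add: proper_fun_def)
  have lin: "linear (k i)" for i
    unfolding k_def[abs_def]
    using linear_compose[OF linear_block matrix_vector_mul_linear] by (simp add: o_def)
  have cont: "continuous_on UNIV (k i)" for i
    by (rule linear_continuous_on) (use lin in \<open>simp add: linear_conv_bounded_linear\<close>)
  show "convex_fun (Q_fun g X :: real^('n \<times> ('b + 'm)) \<Rightarrow> ereal)"
    unfolding Q
    by (rule convex_fun_sum)
       (use convex_fun_compose_linear[OF convex_fun_fenchel lin] nm in \<open>simp_all add: q_def\<close>)
  show "closed_fun (Q_fun g X :: real^('n \<times> ('b + 'm)) \<Rightarrow> ereal)"
    unfolding Q
    by (rule closed_fun_sum)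
       (use closed_fun_compose[OF closed_fun_fenchel cont] nm in \<open>simp_all add: q_def\<close>)
  have "\<forall>i. \<exists>v r. q i v = ereal r"
    using proper proper_fun_real by metis
  then obtain v r where v: "\<And>i. q i (v i) = ereal (r i)" by metis
  \<comment> \<open>Properness of the sum requires one point where all summands are finite.
    \<open>F_mat\<close> reads only the second part of each block, so the points \<open>v i\<close>
    can be stacked independently.\<close>
  define z :: "real^('n \<times> ('b + 'm))"
    where "z = stack (\<lambda>i. \<chi> j. case j of Inl a \<Rightarrow> 0 | Inr c \<Rightarrow> v i $ c)"
  have "k i z = v i" for i
    by (simp add: k_def z_def F_mat_def hcat_mult_vec)
  then have "Q_fun g X z = ereal (\<Sum>i\<in>UNIV. r i)" by (simp add: Q v)
  moreover have "Q_fun g X x \<noteq> -\<infinity>" for x :: "real^('n \<times> ('b + 'm))"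
    unfolding Q by (intro sum_ereal_not_minf nm)
  ultimately show "proper_fun (Q_fun g X :: real^('n \<times> ('b + 'm)) \<Rightarrow> ereal)"
    unfolding proper_fun_def by (metis PInfty_neq_ereal(1))
qed

section \<open>The constraint matrix by rows, and its Gram matrix\<close>

definition M_row ::
  "'n::{finite,linorder} set set \<Rightarrow> nat \<times> 'b::finite \<Rightarrow> real^('n \<times> ('b + 'm::finite))" where
  "M_row E r = (\<chi> c. M_mat E r c)"

lemma M_mult_inner: "M_mult E x r = M_row E r \<bullet> x"
  by (simp add: M_mult_def M_row_def inner_vec_def)

lemma MT_mult_sum: "MT_mult E \<xi> = (\<Sum>r\<in>M_rows E. \<xi> r *\<^sub>R M_row E r)"
  by (simp add: MT_mult_def M_row_def vec_eq_iff mult.commute)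

lemma MTM_mat_mult:
  fixes x :: "real^('n::{finite,linorder} \<times> ('b::finite + 'm::finite))"
  shows "MTM_mat E *v x = (\<Sum>r\<in>M_rows E. (M_row E r \<bullet> x) *\<^sub>R M_row E r)"
proof -
  have "(\<Sum>d\<in>UNIV. (\<Sum>r\<in>M_rows E. M_mat E r c * M_mat E r d) * x $ d)
      = (\<Sum>r\<in>M_rows E. (\<Sum>d\<in>UNIV. M_mat E r d * x $ d) * M_mat E r c)"
    for c :: "'n \<times> ('b + 'm)"
    unfolding sum_distrib_right by (subst sum.swap) (simp add: mult_ac)
  then show ?thesis
    by (simp add: MTM_mat_def M_row_def vec_eq_iff matrix_vector_mult_def inner_vec_def
        del: split_paired_All)
qed

text \<open>The left side is the quadratic form of the symmetric matrix \<open>MTM_mat E\<close> at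
  \<open>x\<close>, so the Rayleigh bound applies.\<close>

lemma MTM_mat_bound:
  fixes x :: "real^('n::{finite,linorder} \<times> ('b::finite + 'm::finite))"
  shows "(\<Sum>r\<in>M_rows E. (M_row E r \<bullet> x)\<^sup>2)
    \<le> largest_eigenvalue (MTM_mat E :: real^('n \<times> ('b + 'm))^('n \<times> ('b + 'm))) * (norm x)\<^sup>2"
proof -
  have "transpose (MTM_mat E) = (MTM_mat E :: real^('n \<times> ('b + 'm))^('n \<times> ('b + 'm)))"
    by (simp add: transpose_def MTM_mat_def vec_eq_iff mult.commute)
  from largest_eigenvalue_symmetric[OF this, of x] show ?thesis
    by (simp add: MTM_mat_mult inner_sum_right power2_eq_square inner_commute[of x])
qed

lemma finite_M_rows: "finite (M_rows E :: (nat \<times> 'b::finite) set)"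
  by (simp add: M_rows_def)

section \<open>DDPG as an instance of the abstract iteration\<close>

theorem theorem1:
  fixes E :: "'n::{finite,linorder} set set"
    and f g :: "'n \<Rightarrow> real^'m::finite \<Rightarrow> ereal"
    and X :: "'n \<Rightarrow> (real^'m) set"
    and A :: "real^('n \<times> 'm)^'b::finite"
    and b :: "real^'b"
    and \<sigma> \<kappa> :: "'n \<Rightarrow> real"
    and c \<gamma> :: real
    and P Q :: "real^('n \<times> ('b + 'm)) \<Rightarrow> ereal"
    and C :: "((real^('n \<times> ('b + 'm))) \<times> (nat \<times> 'b \<Rightarrow> real)) set"
    and lam :: "nat \<Rightarrow> real^('n \<times> ('b + 'm))"
    and \<xi> :: "nat \<Rightarrow> nat \<times> 'b \<Rightarrow> real"
  assumes graph: "simple_graph E" "connected_graph E"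
    and f: "\<And>i. proper_fun (f i)" "\<And>i. convex_fun (f i)" "\<And>i. closed_fun (f i)"
      "\<And>i. differentiable_fun (f i)" "\<And>i. \<sigma> i > 0" "\<And>i. strongly_convex_fun (\<sigma> i) (f i)"
    and g: "\<And>i. proper_fun (g i)" "\<And>i. convex_fun (g i)" "\<And>i. closed_fun (g i)"
    and X: "\<And>i. X i \<noteq> {}" "\<And>i. convex (X i)" "\<And>i. closed (X i)"
    and gX: "\<And>i. proper_fun (\<lambda>x. g i x + indicator_fun (X i) x)"
    and feasible: "\<exists>x \<in> rel_interior {x. \<forall>i. block i x \<in> X i}. A *v x = b"
    and \<kappa>: "(\<Sum>i\<in>UNIV. \<kappa> i) = 1"
    and P_def: "P = P_fun f A b \<kappa>"
    and Q_def: "Q = Q_fun g X"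
    and C_def: "C = saddle_points (lagrangian P Q E)"
    and C_nonempty: "C \<noteq> {}"
    and steps: "c > 0" "\<gamma> > 0"
      "1 / c \<ge> h_const A \<sigma> +
        \<gamma> * largest_eigenvalue (MTM_mat E :: real^('n \<times> ('b + 'm))^('n \<times> ('b + 'm)))"
    and iterates: "ddpg_sequence P Q E c \<gamma> lam \<xi>"
  shows "\<exists>(lam_hat, \<xi>_hat) \<in> C. lam \<longlonglongrightarrow> lam_hat \<and> (\<forall>r\<in>M_rows E. (\<lambda>t. \<xi> t r) \<longlonglongrightarrow> \<xi>_hat r)"
proof -
  obtain p G where p: "\<And>x. P x = ereal (p x)"
      and sub: "\<And>x y. p x + G x \<bullet> (y - x) \<le> p y"
      and coco: "\<And>x y. (norm (G x - G y))\<^sup>2 \<le> h_const A \<sigma> * ((G x - G y) \<bullet> (x - y))"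
    using P_fun_cocoercive_gradient[of f \<sigma> A b \<kappa>] f P_def by metis
  have gX_regular: "convex_fun (\<lambda>x. g i x + indicator_fun (X i) x)"
      "closed_fun (\<lambda>x. g i x + indicator_fun (X i) x)" for i
    by (intro add_indicator_fun_regular g X)+
  have Q: "proper_fun Q" "convex_fun Q" "closed_fun Q"
    unfolding Q_def by (intro Q_fun_regular gX gX_regular)+
  \<comment> \<open>The Rayleigh bound turns the scalar step-size condition into the operator
    inequality \<open>I / c - \<gamma> M^T M \<ge> h I\<close>.\<close>
  have step: "h_const A \<sigma> * (norm x)\<^sup>2 + \<gamma> * (\<Sum>r\<in>M_rows E. (M_row E r \<bullet> x)\<^sup>2)
      \<le> 1 / c * (norm x)\<^sup>2" for x :: "real^('n \<times> ('b + 'm))"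
  proof -
    let ?\<tau> = "largest_eigenvalue (MTM_mat E :: real^('n \<times> ('b + 'm))^('n \<times> ('b + 'm)))"
    have "\<gamma> * (\<Sum>r\<in>M_rows E. (M_row E r \<bullet> x)\<^sup>2) \<le> \<gamma> * (?\<tau> * (norm x)\<^sup>2)"
      using steps(2) by (intro mult_left_mono MTM_mat_bound) simp
    moreover have "(h_const A \<sigma> + \<gamma> * ?\<tau>) * (norm x)\<^sup>2 \<le> 1 / c * (norm x)\<^sup>2"
      using steps(3) by (intro mult_right_mono) simp_all
    ultimately show ?thesis by (simp add: algebra_simps)
  qed
  \<comment> \<open>The rows of the function-valued matrix \<open>M_mat E\<close> enter as Euclidean
    vectors \<open>M_row E r\<close>, so that \<open>M\<close> acts by inner products.\<close>
  interpret primal_dual p G Q "M_row E" "M_rows E" c \<gamma> "h_const A \<sigma>"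
    using sub coco Q steps(1,2) step h_const_pos[OF f(5)]
    by unfold_locales (auto simp: finite_M_rows)
  have P: "P = (\<lambda>x. ereal (p x))" by (simp add: p fun_eq_iff)
  have lag: "lagrangian P Q E = lag"
    by (simp add: fun_eq_iff lagrangian_def lag_def p M_mult_inner)
  have adj: "MT_mult E = adj"
    by (simp add: fun_eq_iff MT_mult_sum adj_def)
  have MTM: "MTM_mat E *v x = adj (\<lambda>r. M_row E r \<bullet> x)" for x
    by (simp add: MTM_mat_mult adj_def)
  interpret primal_dual_iteration p G Q "M_row E" "M_rows E" c \<gamma> "h_const A \<sigma>" lam \<xi>
    using iterates unfolding ddpg_sequence_def P p_gradient adj MTM M_mult_inner
    by unfold_locales auto
  \<comment> \<open>Any saddle point serves as the first centre of the Lyapunov function; the limit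
    may be a different one.\<close>
  obtain ls xs where "(ls, xs) \<in> C" using C_nonempty by auto
  then have "kkt ls xs" using saddle_imp_kkt by (simp add: C_def lag)
  from iterates_converge[OF this] obtain lh xh where
    "kkt lh xh" "lam \<longlonglongrightarrow> lh" "\<forall>r\<in>M_rows E. (\<lambda>t. \<xi> t r) \<longlonglongrightarrow> xh r" by blast
  moreover from this(1) have "(lh, xh) \<in> C" by (simp add: C_def lag kkt_imp_saddle)
  ultimately show ?thesis by blast
qed

end
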